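(* Let $m\ge 1$ and let $\mathcal{F}$ be a codimension one linear foliation with dense leaves on the torus $T^{m+1}$. Then there is an integer $r$ with $0\le r\le m$ such that $\mathrm{Diff}(T^{m+1}/\mathcal{F})$ is isomorphic to $$(\mathbb{Z}_2\times\underbrace{\mathbb{Z}\times\cdots\times\mathbb{Z}}_{r})\ltimes (T^{m+1}/\mathcal{F}),$$ where $T^{m+1}/\mathcal{F}$ is identified with the group $\mathbb{R}/\Gamma$, $\Gamma$ being the holonomy group of $\mathcal{F}$, and $\mathbb{Z}_2\times\mathbb{Z}^r\cong \mathrm{Aut}_\Gamma(\mathbb{R})$ acts on $\mathbb{R}/\Gamma$ in the natural way.
   Context: A codimension one linear foliation with dense leaves on $T^{m+1}=\mathbb{R}^{m+1}/\mathbb{Z}^{m+1}$ is given by the kernel of a closed $1$-form $\omega=dy-\xi_1dx_1-\cdots-\xi_m dx_m$ with constants $\xi_1,\dots,\xi_m\in\mathbb{R}$, at least one of them irrational. Its holonomy group is the (dense, finitely generated) subgroup $\Gamma=\langle 1,\xi_1,\dots,\xi_m\rangle\subset\mathbb{R}$. $\mathrm{Aut}_\Gamma(\mathbb{R})$ is the group of linear automorphisms $t\mapsto\lambda t$, $\lambda\neq 0$, of $\mathbb{R}$ with $\lambda\Gamma=\Gamma$; it acts on $\mathbb{R}/\Gamma$ by $[t]\mapsto[\lambda t]$. The space of leaves $T^{m+1}/\mathcal{F}$ is endowed with the quotient diffeology (its plots are the maps from open sets $U$ of some $\mathbb{R}^p$ which locally lift to $\mathcal{C}^\infty$ maps into $T^{m+1}$);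 it is diffeomorphic to $\mathbb{R}/\Gamma$ with its quotient diffeology (plots locally lift to $\mathcal{C}^\infty$ maps into $\mathbb{R}$). A map of diffeological spaces is differentiable if it carries plots to plots by composition, and $\mathrm{Diff}$ denotes the group of differentiable bijections with differentiable inverse. *)

theory Defs
  imports "HOL-Analysis.Analysis" "HOL-Algebra.Algebra"
begin

section \<open>Diffeologies\<close>

text \<open>
  \<open>\<real>\<^sup>p\<close>, with \<open>p\<close> a natural number, is \<^term>\<open>Euclidean_space p\<close>: the sequences vanishing from
  index \<open>p\<close> on. Open subsets of \<open>\<real>\<^sup>p\<close> are given by \<^term>\<open>openin (Euclidean_space p)\<close>, and maps on
  them are total functions whose values outside the domain are irrelevant.
  The predicate \<open>C_k k p U f\<close> says that on the open set \<open>U\<close> all iterated partial derivatives of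
  \<open>f\<close> of order at most \<open>k\<close> exist and are continuous; \<open>g i\<close> is the \<open>i\<close>-th partial derivative.
\<close>

primrec C_k :: "nat \<Rightarrow> nat \<Rightarrow> (nat \<Rightarrow> real) set \<Rightarrow> ((nat \<Rightarrow> real) \<Rightarrow> 'a::real_normed_vector) \<Rightarrow> bool"
  where
    "C_k 0 p U f \<longleftrightarrow> continuous_on U f"
  | "C_k (Suc k) p U f \<longleftrightarrow> continuous_on U f \<and>
       (\<exists>g. \<forall>i<p. (\<forall>x\<in>U. ((\<lambda>t. f (x(i := t))) has_vector_derivative g i x) (at (x i)))
                   \<and> C_k k p U (g i))"

definition C_infinity :: "nat \<Rightarrow> (nat \<Rightarrow> real) set \<Rightarrow> ((nat \<Rightarrow> real) \<Rightarrow> 'a::real_normed_vector) \<Rightarrow> bool"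
  where "C_infinity p U f \<longleftrightarrow> (\<forall>k. C_k k p U f)"

text \<open>A diffeology is given by its plots: \<open>D p U u\<close> means that \<open>U\<close> is open in \<open>\<real>\<^sup>p\<close> and that
  \<open>u\<close>, restricted to \<open>U\<close>, is a plot.\<close>

type_synonym 'a diffeology = "nat \<Rightarrow> (nat \<Rightarrow> real) set \<Rightarrow> ((nat \<Rightarrow> real) \<Rightarrow> 'a) \<Rightarrow> bool"

definition standard_diffeology :: "'a::real_normed_vector diffeology"
  where "standard_diffeology p U u \<longleftrightarrow> openin (Euclidean_space p) U \<and> C_infinity p U u"

definition quotient_diffeology :: "('a \<Rightarrow> 'b) \<Rightarrow> 'a diffeology \<Rightarrow> 'b diffeology"
  where "quotient_diffeology \<pi> D p U u \<longleftrightarrow> openin (Euclidean_space p) U \<and>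
           (\<forall>x\<in>U. \<exists>V f. x \<in> V \<and> V \<subseteq> U \<and> D p V f \<and> (\<forall>y\<in>V. u y = \<pi> (f y)))"

definition diff_map :: "'a diffeology \<Rightarrow> 'b diffeology \<Rightarrow> ('a \<Rightarrow> 'b) \<Rightarrow> bool"
  where "diff_map D E f \<longleftrightarrow> (\<forall>p U u. D p U u \<longrightarrow> E p U (f \<circ> u))"

definition diff_iso :: "'a set \<Rightarrow> 'a diffeology \<Rightarrow> 'b set \<Rightarrow> 'b diffeology \<Rightarrow> ('a \<Rightarrow> 'b) \<Rightarrow> bool"
  where "diff_iso A D B E f \<longleftrightarrow>
           bij_betw f A B \<and> diff_map D E f \<and> diff_map E D (inv_into A f)"

definition Diff :: "'a set \<Rightarrow> 'a diffeology \<Rightarrow> ('a \<Rightarrow> 'a) monoid"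
  where "Diff A D = (BijGroup A)\<lparr>carrier := {f \<in> Bij A. diff_iso A D A D f}\<rparr>"


section \<open>Linear foliations of the torus and their leaf spaces\<close>

text \<open>Points of \<open>\<real>\<^sup>m\<^sup>+\<^sup>1\<close> are pairs \<open>(x, y)\<close> with \<open>x\<close> in \<open>\<real>\<^sup>m\<close>, where \<open>m\<close> is the cardinality of the
  index type. Points of the torus are cosets of the integer lattice.\<close>

definition int_lattice :: "((real^'m) \<times> real) set"
  where "int_lattice = {v. (\<forall>i. fst v $ i \<in> \<int>) \<and> snd v \<in> \<int>}"

definition torus_proj :: "(real^'m) \<times> real \<Rightarrow> ((real^'m) \<times> real) set"
  where "torus_proj p = {q. q - p \<in> int_lattice}"

definition torus_diffeology :: "((real^'m) \<times> real) set diffeology"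
  where "torus_diffeology = quotient_diffeology torus_proj standard_diffeology"

definition omega :: "real^'m \<Rightarrow> (real^'m) \<times> real \<Rightarrow> real"
  where "omega \<xi> v = snd v - (\<Sum>i\<in>UNIV. \<xi> $ i * fst v $ i)"

text \<open>The leaf through a point \<open>P\<close> of the torus is the image of an affine hyperplane parallel to
  the kernel of \<^term>\<open>omega \<xi>\<close> through any representative of \<open>P\<close>; all representatives yield the
  same set.\<close>

definition leaf :: "real^'m \<Rightarrow> ((real^'m) \<times> real) set \<Rightarrow> ((real^'m) \<times> real) set set"
  where "leaf \<xi> P = torus_proj ` {q. \<exists>p\<in>P. omega \<xi> (q - p) = 0}"

definition leaf_space :: "real^'m \<Rightarrow> ((real^'m) \<times> real) set set set"
  where "leaf_space \<xi> = leaf \<xi> ` range torus_proj"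

definition leaf_diffeology :: "real^'m \<Rightarrow> ((real^'m) \<times> real) set set diffeology"
  where "leaf_diffeology \<xi> = quotient_diffeology (leaf \<xi>) torus_diffeology"


section \<open>The holonomy group and its automorphisms\<close>

definition real_group :: "real monoid"
  where "real_group = \<lparr>carrier = UNIV, monoid.mult = (+), one = 0\<rparr>"

definition holonomy :: "real^'m \<Rightarrow> real set"
  where "holonomy \<xi> = generate real_group (insert 1 (range (($) \<xi>)))"

definition Aut_lin :: "real set \<Rightarrow> (real \<Rightarrow> real) monoid"
  where "Aut_lin \<Gamma> = (BijGroup UNIV)
           \<lparr>carrier := {f. \<exists>c. c \<noteq> 0 \<and> f = (\<lambda>t. c * t) \<and> f ` \<Gamma> = \<Gamma>}\<rparr>"

text \<open>The operation of \<open>H \<ltimes> N\<close>, where \<open>H\<close> acts on \<open>N\<close> from the left by \<open>act\<close>.\<close>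

definition semidirect ::
    "('h, 'x) monoid_scheme \<Rightarrow> ('n, 'y) monoid_scheme \<Rightarrow> ('h \<Rightarrow> 'n \<Rightarrow> 'n) \<Rightarrow> ('h \<times> 'n) monoid"
  where "semidirect H N act =
           \<lparr>carrier = carrier H \<times> carrier N,
            monoid.mult = (\<lambda>(h, n) (h', n'). (h \<otimes>\<^bsub>H\<^esub> h', n \<otimes>\<^bsub>N\<^esub> act h n')),
            one = (\<one>\<^bsub>H\<^esub>, \<one>\<^bsub>N\<^esub>)\<rparr>"

definition Z2_times_Z_power :: "nat \<Rightarrow> (int \<times> (nat \<Rightarrow> int)) monoid"
  where "Z2_times_Z_power r = integer_mod_group 2 \<times>\<times> product_group {..<r} (\<lambda>_. integer_group)"


section \<open>The leaf space is diffeomorphic to the quotient by the holonomy group\<close>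

abbreviation real_quot :: "real set \<Rightarrow> real set monoid"
  where "real_quot \<Gamma> \<equiv> real_group Mod \<Gamma>"

definition real_quot_diffeology :: "real set \<Rightarrow> real set diffeology"
  where "real_quot_diffeology \<Gamma> = quotient_diffeology (\<lambda>t. \<Gamma> #>\<^bsub>real_group\<^esub> t) standard_diffeology"

definition leaf_to_coset :: "real^'m \<Rightarrow> ((real^'m) \<times> real) set set \<Rightarrow> real set"
  where "leaf_to_coset \<xi> L = omega \<xi> ` \<Union>L"

lemma C_k_subset: "C_k k p U f \<Longrightarrow> V \<subseteq> U \<Longrightarrow> C_k k p V f"
proof (induction k arbitrary: f)
  case 0
  then show ?case by (auto intro: continuous_on_subset)
next
  case (Suc k)
  then obtain g where g: "continuous_on U f"
    "\<forall>i<p. (\<forall>x\<in>U. ((\<lambda>t. f (x(i := t))) has_vector_derivative g i x) (at (x i))) \<and> C_k k p U (g i)"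
    by auto
  then have "\<forall>i<p. (\<forall>x\<in>V. ((\<lambda>t. f (x(i := t))) has_vector_derivative g i x) (at (x i)))
               \<and> C_k k p V (g i)"
    using Suc by blast
  with g(1) Suc.prems(2) show ?case by (auto intro: continuous_on_subset)
qed

lemma C_k_linear:
  assumes h: "bounded_linear h" and f: "C_k k p U f"
  shows "C_k k p U (\<lambda>x. h (f x))"
  using f
proof (induction k arbitrary: f)
  case 0
  then show ?case by (simp add: bounded_linear.continuous_on[OF h])
next
  case (Suc k)
  then obtain g where g: "continuous_on U f"
    "\<forall>i<p. (\<forall>x\<in>U. ((\<lambda>t. f (x(i := t))) has_vector_derivative g i x) (at (x i))) \<and> C_k k p U (g i)"
    by auto
  then have "\<forall>i<p. (\<forall>x\<in>U. ((\<lambda>t. h (f (x(i := t)))) has_vector_derivative h (g i x)) (at (x i)))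
               \<and> C_k k p U (\<lambda>x. h (g i x))"
    using Suc by (auto intro: bounded_linear.has_vector_derivative[OF h])
  then show ?case
    using g(1) by (auto intro!: bounded_linear.continuous_on[OF h] exI[of _ "\<lambda>i x. h (g i x)"])
qed

lemma standard_diffeology_linear:
  "bounded_linear h \<Longrightarrow> standard_diffeology p U u \<Longrightarrow> standard_diffeology p U (\<lambda>x. h (u x))"
  by (auto simp: standard_diffeology_def C_infinity_def intro: C_k_linear)

lemma standard_diffeology_subset:
  "standard_diffeology p U u \<Longrightarrow> openin (Euclidean_space p) V \<Longrightarrow> V \<subseteq> U \<Longrightarrow> standard_diffeology p V u"
  by (auto simp: standard_diffeology_def C_infinity_def intro: C_k_subset)

lemma group_real_group: "group real_group"
  by (rule groupI) (auto simp: real_group_def intro: exI[of _ "- _"])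

lemma bounded_linear_omega: "bounded_linear (omega \<xi>)"
  unfolding omega_def
  by (intro bounded_linear_intros bounded_linear_sum bounded_linear_const_mult
      bounded_linear_compose[OF bounded_linear_vec_nth])

lemma omega_diff: "omega \<xi> (u - v) = omega \<xi> u - omega \<xi> v"
  by (rule linear_diff[OF bounded_linear.linear[OF bounded_linear_omega]])

lemma omega_add: "omega \<xi> (u + v) = omega \<xi> u + omega \<xi> v"
  by (rule linear_add[OF bounded_linear.linear[OF bounded_linear_omega]])

lemma int_lattice_add: "u \<in> int_lattice \<Longrightarrow> v \<in> int_lattice \<Longrightarrow> u + v \<in> int_lattice"
  and int_lattice_minus: "u \<in> int_lattice \<Longrightarrow> - u \<in> int_lattice"
  by (auto simp: int_lattice_def)

lemma torus_proj_self: "p \<in> torus_proj p"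
  by (simp add: torus_proj_def int_lattice_def)

lemma subgroup_holonomy: "subgroup (holonomy \<xi>) real_group"
  unfolding holonomy_def
  by (rule group.generate_is_subgroup[OF group_real_group]) (simp add: real_group_def)

lemma holonomy_zero: "0 \<in> holonomy \<xi>"
  using subgroup.one_closed[OF subgroup_holonomy] by (simp add: real_group_def)

lemma holonomy_add: "a \<in> holonomy \<xi> \<Longrightarrow> b \<in> holonomy \<xi> \<Longrightarrow> a + b \<in> holonomy \<xi>"
  using subgroup.m_closed[OF subgroup_holonomy] by (simp add: real_group_def)

lemma inv_real_group: "inv\<^bsub>real_group\<^esub> a = - a"
  by (rule group.inv_equality[OF group_real_group]) (auto simp: real_group_def)

lemma holonomy_minus: "a \<in> holonomy \<xi> \<Longrightarrow> - a \<in> holonomy \<xi>"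
  using subgroup.m_inv_closed[OF subgroup_holonomy] by (simp add: inv_real_group)

lemma holonomy_int_mult:
  assumes "a \<in> holonomy \<xi>" and "k \<in> \<int>"
  shows "a * k \<in> holonomy \<xi>"
proof -
  have n: "a * of_nat n \<in> holonomy \<xi>" for n :: nat
    by (induction n) (auto simp: algebra_simps holonomy_zero intro: holonomy_add assms)
  obtain z where z: "k = of_int z" using assms(2) by (auto elim: Ints_cases)
  show ?thesis
  proof (cases "z \<ge> 0")
    case True
    then show ?thesis using n[of "nat z"] z by simp
  next
    case False
    then show ?thesis using holonomy_minus[OF n[of "nat (- z)"]] z by simp
  qed
qed

lemma holonomy_eq:
  fixes \<xi> :: "real^'a"
  shows "holonomy \<xi> = omega \<xi> ` int_lattice"
proof
  have 1: "omega \<xi> (0, 1) = 1" "((0, 1) :: (real^'a) \<times> real) \<in> int_lattice"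
    by (simp_all add: omega_def int_lattice_def)
  have 2: "omega \<xi> (- axis i 1, 0) = \<xi> $ i" "((- axis i 1, 0) :: (real^'a) \<times> real) \<in> int_lattice" for i
    by (simp_all add: omega_def int_lattice_def axis_def if_distrib sum_negf cong: if_cong)
  have gen: "1 \<in> omega \<xi> ` int_lattice" "\<xi> $ i \<in> omega \<xi> ` int_lattice" for i
    using 1 2[of i] by (metis imageI)+
  show "holonomy \<xi> \<subseteq> omega \<xi> ` int_lattice"
  proof
    fix a assume "a \<in> holonomy \<xi>"
    then show "a \<in> omega \<xi> ` int_lattice"
      unfolding holonomy_def
    proof (induction rule: generate.induct)
      case one
      have "omega \<xi> 0 = 0" by (simp add: omega_def)
      moreover have "(0 :: (real^'a) \<times> real) \<in> int_lattice" by (simp add: int_lattice_def)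
      ultimately show ?case by (metis real_group_def monoid.simps(2) imageI)
    next
      case (incl h)
      then show ?case using gen by auto
    next
      case (inv h)
      then have "h \<in> omega \<xi> ` int_lattice" using gen by auto
      then obtain v where v: "h = omega \<xi> v" "v \<in> int_lattice" by (rule imageE)
      have "- h = omega \<xi> (- v)" by (simp add: v linear_neg[OF bounded_linear.linear[OF bounded_linear_omega]])
      then show ?case using int_lattice_minus[OF v(2)] by (simp add: inv_real_group)
    next
      case (eng h1 h2)
      then obtain v1 v2 where v: "h1 = omega \<xi> v1" "v1 \<in> int_lattice" "h2 = omega \<xi> v2" "v2 \<in> int_lattice"
        by auto
      have "h1 + h2 = omega \<xi> (v1 + v2)" by (simp add: v omega_add)
      then show ?case using int_lattice_add[OF v(2,4)] by (simp add: real_group_def)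
    qed
  qed
next
  have gen: "1 \<in> holonomy \<xi>" "\<xi> $ i \<in> holonomy \<xi>" for i
    unfolding holonomy_def by (auto intro: generate.incl)
  show "omega \<xi> ` int_lattice \<subseteq> holonomy \<xi>"
  proof clarify
    fix x :: "real^'a" and y :: real assume xy: "(x, y) \<in> int_lattice"
    have s: "(\<Sum>i\<in>I. \<xi> $ i * x $ i) \<in> holonomy \<xi>" if "finite I" for I
      using that by (induction I rule: finite_induct)
        (use xy in \<open>auto simp: int_lattice_def holonomy_zero intro!: holonomy_add holonomy_int_mult gen\<close>)
    have "y \<in> holonomy \<xi>"
      using holonomy_int_mult[OF gen(1), of y] xy by (simp add: int_lattice_def)
    then show "omega \<xi> (x, y) \<in> holonomy \<xi>"
      using holonomy_add[OF _ holonomy_minus[OF s[OF finite]]] by (simp add: omega_def)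
  qed
qed

lemma coset_eq: "holonomy \<xi> #>\<^bsub>real_group\<^esub> t = {s. s - t \<in> holonomy \<xi>}"
  by (force simp: r_coset_def real_group_def)

lemma mem_Union_leaf: "q \<in> \<Union>(leaf \<xi> (torus_proj p)) \<longleftrightarrow> omega \<xi> q - omega \<xi> p \<in> holonomy \<xi>"
proof
  assume "q \<in> \<Union>(leaf \<xi> (torus_proj p))"
  then obtain q' p' where "q - q' \<in> int_lattice" "p' - p \<in> int_lattice" "omega \<xi> (q' - p') = 0"
    by (auto simp: leaf_def torus_proj_def)
  moreover from this have "omega \<xi> q - omega \<xi> p = omega \<xi> ((q - q') + (p' - p))"
    by (simp add: omega_diff omega_add)
  ultimately show "omega \<xi> q - omega \<xi> p \<in> holonomy \<xi>"
    unfolding holonomy_eq by (metis imageI int_lattice_add)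
next
  assume "omega \<xi> q - omega \<xi> p \<in> holonomy \<xi>"
  then obtain v where v: "v \<in> int_lattice" "omega \<xi> q - omega \<xi> p = omega \<xi> v"
    by (auto simp: holonomy_eq)
  then have "omega \<xi> (q - (p + v)) = 0" "p + v \<in> torus_proj p"
    by (simp_all add: omega_diff omega_add torus_proj_def)
  then show "q \<in> \<Union>(leaf \<xi> (torus_proj p))"
    unfolding leaf_def using torus_proj_self[of q] by blast
qed

lemma leaf_to_coset_leaf:
  "leaf_to_coset \<xi> (leaf \<xi> (torus_proj p)) = holonomy \<xi> #>\<^bsub>real_group\<^esub> omega \<xi> p"
proof -
  have "s \<in> omega \<xi> ` \<Union>(leaf \<xi> (torus_proj p))" if "s - omega \<xi> p \<in> holonomy \<xi>" for s
  proof -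
    have "omega \<xi> (0, s) = s" by (simp add: omega_def)
    with that mem_Union_leaf[of "(0, s)" \<xi> p] show ?thesis by (metis image_eqI)
  qed
  then show ?thesis
    unfolding leaf_to_coset_def coset_eq using mem_Union_leaf[of _ \<xi> p] by blast
qed

lemma leaf_eqI:
  assumes "omega \<xi> p - omega \<xi> p' \<in> holonomy \<xi>"
  shows "leaf \<xi> (torus_proj p) \<subseteq> leaf \<xi> (torus_proj p')"
proof
  fix Q assume "Q \<in> leaf \<xi> (torus_proj p)"
  then obtain q p1 where q: "Q = torus_proj q" "p1 - p \<in> int_lattice" "omega \<xi> (q - p1) = 0"
    by (auto simp: leaf_def torus_proj_def)
  obtain v where v: "v \<in> int_lattice" "omega \<xi> p - omega \<xi> p' = omega \<xi> v"
    using assms by (auto simp: holonomy_eq)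
  have "omega \<xi> (q - (p' + ((p1 - p) + v))) = 0"
    using q(3) v(2) by (simp add: omega_diff omega_add)
  moreover have "p' + ((p1 - p) + v) \<in> torus_proj p'"
    using q(2) v(1) by (simp add: torus_proj_def int_lattice_add)
  ultimately show "Q \<in> leaf \<xi> (torus_proj p')"
    unfolding leaf_def q(1) by blast
qed

lemma bij_betw_leaf_to_coset:
  "bij_betw (leaf_to_coset \<xi>) (leaf_space \<xi>) (carrier (real_quot (holonomy \<xi>)))"
  unfolding bij_betw_def
proof
  have "leaf \<xi> (torus_proj p) = leaf \<xi> (torus_proj p')"
    if "leaf_to_coset \<xi> (leaf \<xi> (torus_proj p)) = leaf_to_coset \<xi> (leaf \<xi> (torus_proj p'))" for p p'
  proof -
    have "omega \<xi> p - omega \<xi> p' \<in> holonomy \<xi>"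
      using that holonomy_zero[of \<xi>] unfolding leaf_to_coset_leaf coset_eq by auto
    moreover from holonomy_minus[OF this] have "omega \<xi> p' - omega \<xi> p \<in> holonomy \<xi>" by simp
    ultimately show ?thesis by (intro equalityI leaf_eqI)
  qed
  then show "inj_on (leaf_to_coset \<xi>) (leaf_space \<xi>)"
    unfolding inj_on_def leaf_space_def by blast
  have "holonomy \<xi> #>\<^bsub>real_group\<^esub> t \<in> leaf_to_coset \<xi> ` leaf_space \<xi>" for t
  proof -
    have "omega \<xi> (0, t) = t" by (simp add: omega_def)
    then show ?thesis
      using leaf_to_coset_leaf[of \<xi> "(0, t)"] unfolding leaf_space_def by (metis rangeI imageI)
  qed
  then show "leaf_to_coset \<xi> ` leaf_space \<xi> = carrier (real_quot (holonomy \<xi>))"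
    by (auto simp: FactGroup_def RCOSETS_def leaf_space_def leaf_to_coset_leaf)
      (auto simp: real_group_def)
qed

theorem diff_iso_leaf_to_coset:
  "diff_iso (leaf_space \<xi>) (leaf_diffeology \<xi>)
     (carrier (real_quot (holonomy \<xi>))) (real_quot_diffeology (holonomy \<xi>)) (leaf_to_coset \<xi>)"
  unfolding diff_iso_def diff_map_def
proof (intro conjI allI impI)
  show bij: "bij_betw (leaf_to_coset \<xi>) (leaf_space \<xi>) (carrier (real_quot (holonomy \<xi>)))"
    by (rule bij_betw_leaf_to_coset)
  fix p U
  show "real_quot_diffeology (holonomy \<xi>) p U (leaf_to_coset \<xi> \<circ> u)"
    if u: "leaf_diffeology \<xi> p U u" for u
    unfolding real_quot_diffeology_def quotient_diffeology_def
  proof (intro conjI ballI)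
    show "openin (Euclidean_space p) U"
      using u by (simp add: leaf_diffeology_def quotient_diffeology_def)
    fix x assume "x \<in> U"
    then obtain V f where V: "x \<in> V" "V \<subseteq> U" "torus_diffeology p V f" "\<forall>y\<in>V. u y = leaf \<xi> (f y)"
      using u by (auto simp: leaf_diffeology_def quotient_diffeology_def)
    then obtain W g where W: "x \<in> W" "W \<subseteq> V" "standard_diffeology p W g"
      "\<forall>y\<in>W. f y = torus_proj (g y)"
      by (auto simp: torus_diffeology_def quotient_diffeology_def)
    have "\<forall>y\<in>W. (leaf_to_coset \<xi> \<circ> u) y = holonomy \<xi> #>\<^bsub>real_group\<^esub> omega \<xi> (g y)"
    proof
      fix y assume y: "y \<in> W"
      then have "y \<in> V" using W(2) by (rule subsetD[rotated])
      then show "(leaf_to_coset \<xi> \<circ> u) y = holonomy \<xi> #>\<^bsub>real_group\<^esub> omega \<xi> (g y)"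
        using y V(4) W(4) by (simp add: leaf_to_coset_leaf)
    qed
    moreover have "standard_diffeology p W (\<lambda>y. omega \<xi> (g y))"
      by (rule standard_diffeology_linear[OF bounded_linear_omega W(3)])
    ultimately show "\<exists>V f. x \<in> V \<and> V \<subseteq> U \<and> standard_diffeology p V f \<and>
        (\<forall>y\<in>V. (leaf_to_coset \<xi> \<circ> u) y = holonomy \<xi> #>\<^bsub>real_group\<^esub> f y)"
      using V(2) W(1,2) by (intro exI[of _ W] exI[of _ "\<lambda>y. omega \<xi> (g y)"]) auto
  qed
  show "leaf_diffeology \<xi> p U (inv_into (leaf_space \<xi>) (leaf_to_coset \<xi>) \<circ> u)"
    if u: "real_quot_diffeology (holonomy \<xi>) p U u" for u
    unfolding leaf_diffeology_def quotient_diffeology_def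
  proof (intro conjI ballI)
    show "openin (Euclidean_space p) U"
      using u by (simp add: real_quot_diffeology_def quotient_diffeology_def)
    fix x assume "x \<in> U"
    then obtain V f where V: "x \<in> V" "V \<subseteq> U" "standard_diffeology p V f"
      "\<forall>y\<in>V. u y = holonomy \<xi> #>\<^bsub>real_group\<^esub> f y"
      using u by (auto simp: real_quot_diffeology_def quotient_diffeology_def)
    let ?g = "\<lambda>y. (0 :: real^'a, f y)"
    have lin: "bounded_linear (\<lambda>t::real. (0 :: real^'a, t))"
      by (intro bounded_linear_Pair bounded_linear_zero bounded_linear_ident)
    have g: "standard_diffeology p V ?g"
      by (rule standard_diffeology_linear[OF lin V(3)])
    have "torus_diffeology p V (\<lambda>y. torus_proj (?g y))"
      unfolding torus_diffeology_def quotient_diffeology_def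
    proof (intro conjI ballI)
      show "openin (Euclidean_space p) V"
        using V(3) by (simp add: standard_diffeology_def)
      show "\<exists>V' f'. z \<in> V' \<and> V' \<subseteq> V \<and> standard_diffeology p V' f' \<and>
          (\<forall>y\<in>V'. torus_proj (?g y) = torus_proj (f' y))" if "z \<in> V" for z
        using g that by (intro exI[of _ V] exI[of _ ?g]) simp
    qed
    moreover have "\<forall>y\<in>V. (inv_into (leaf_space \<xi>) (leaf_to_coset \<xi>) \<circ> u) y = leaf \<xi> (torus_proj (?g y))"
    proof
      fix y assume y: "y \<in> V"
      have "omega \<xi> (?g y) = f y" by (simp add: omega_def)
      then have "u y = leaf_to_coset \<xi> (leaf \<xi> (torus_proj (?g y)))"
        using y V(4) by (simp add: leaf_to_coset_leaf)
      then show "(inv_into (leaf_space \<xi>) (leaf_to_coset \<xi>) \<circ> u) y = leaf \<xi> (torus_proj (?g y))"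
        using bij by (simp add: bij_betw_def leaf_space_def)
    qed
    ultimately show "\<exists>V f. x \<in> V \<and> V \<subseteq> U \<and> torus_diffeology p V f \<and>
        (\<forall>y\<in>V. (inv_into (leaf_space \<xi>) (leaf_to_coset \<xi>) \<circ> u) y = leaf \<xi> (f y))"
      using V(1,2) by (intro exI[of _ V] exI[of _ "\<lambda>y. torus_proj (?g y)"]) simp
  qed
qed

end

theory Submission
  imports Defs "Jordan_Normal_Form.Schur_Decomposition"
begin

text \<open>
  A diffeomorphism of \<open>\<real>/\<Gamma>\<close> lifts locally to a smooth \<open>F\<close>. Since \<open>\<Gamma>\<close> is countable,
  \<open>F (y + \<gamma>) - F y\<close> is locally constant for \<open>\<gamma> \<in> \<Gamma>\<close>, so \<open>F'\<close> is invariant under \<open>\<Gamma>\<close>, and it is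
  constant because \<open>\<Gamma>\<close> is dense. Hence the diffeomorphisms are the maps \<open>[t] \<mapsto> [c t + b]\<close> with
  \<open>c \<Gamma> = \<Gamma>\<close>. The multipliers \<open>c\<close> are the units of the ring \<open>{c. c \<Gamma> \<subseteq> \<Gamma>}\<close>, which is an order in
  a number field of degree at most \<open>m + 1\<close>; the easy half of Dirichlet's unit theorem (the
  logarithmic embedding has discrete image in a hyperplane) shows that the positive ones form a
  free abelian group of rank at most \<open>m\<close>.
\<close>

text \<open>The embeddings of the number field are never constructed. A multiplier acts on the free
  group \<Gamma> by an integer matrix, these matrices commute, and a common triangular form over the
  complex numbers turns each diagonal position into a multiplicative character of the ring. The unit
  argument needs only the characteristic polynomial and the determinant, both read off the diagonal.
  Conjugate characters are not identified, so the bound on the rank is \<open>n - 1\<close>, with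
  \<open>n\<close> the rank of \<Gamma>; this is enough for the claimed range of \<open>r\<close>.

  Positive units are recorded by their logarithms, so that they form a subgroup of the real line,
  just as \<Gamma> does. Torsion is thus excluded from the outset, and a single lattice theorem for
  such subgroups, with an arbitrary finite list of additive maps, serves twice: with coordinates it
  gives the ring a finite basis, with logarithms it gives one to the units. The sign of a multiplier
  yields the factor of order two. Countability of \<Gamma> also acts twice: it controls the local
  lift, and it makes the slope \<open>c\<close> of a diffeomorphism unique.\<close>

no_notation vec_index (infixl "$" 100)
notation vec_index (infixl "$v" 100)

section \<open>Finitely generated groups of real numbers\<close>

definition real_subgroup :: "real set \<Rightarrow> bool"
  where "real_subgroup G \<longleftrightarrow> 0 \<in> G \<and> (\<forall>x\<in>G. \<forall>y\<in>G. x - y \<in> G)"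

definition int_comb :: "(nat \<Rightarrow> real) \<Rightarrow> nat \<Rightarrow> (nat \<Rightarrow> int) \<Rightarrow> real"
  where "int_comb b n c = (\<Sum>i<n. of_int (c i) * b i)"

definition int_span :: "(nat \<Rightarrow> real) \<Rightarrow> nat \<Rightarrow> real set"
  where "int_span b n = range (int_comb b n)"

definition int_indep :: "(nat \<Rightarrow> real) \<Rightarrow> nat \<Rightarrow> bool"
  where "int_indep b n \<longleftrightarrow> (\<forall>c. int_comb b n c = 0 \<longrightarrow> (\<forall>i<n. c i = 0))"

lemma real_subgroup_0: "real_subgroup G \<Longrightarrow> 0 \<in> G"
  and real_subgroup_diff: "real_subgroup G \<Longrightarrow> x \<in> G \<Longrightarrow> y \<in> G \<Longrightarrow> x - y \<in> G"
  by (auto simp: real_subgroup_def)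

lemma real_subgroup_minus: "real_subgroup G \<Longrightarrow> x \<in> G \<Longrightarrow> - x \<in> G"
  using real_subgroup_diff[of G 0 x] real_subgroup_0 by simp

lemma real_subgroup_add: "real_subgroup G \<Longrightarrow> x \<in> G \<Longrightarrow> y \<in> G \<Longrightarrow> x + y \<in> G"
  using real_subgroup_diff[of G x "- y"] real_subgroup_minus by simp

lemma real_subgroup_of_int_mult:
  assumes "real_subgroup G" "x \<in> G"
  shows "of_int k * x \<in> G"
proof -
  have n: "of_nat n * x \<in> G" for n :: nat
    by (induction n) (auto simp: algebra_simps intro: real_subgroup_0 real_subgroup_add assms)
  show ?thesis
  proof (cases "k \<ge> 0")
    case True
    then show ?thesis using n[of "nat k"] by simp
  next
    case False
    then show ?thesis using real_subgroup_minus[OF assms(1) n[of "nat (- k)"]] by simp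
  qed
qed

lemma real_subgroup_int_comb:
  assumes "real_subgroup G" "\<And>i. i < n \<Longrightarrow> b i \<in> G"
  shows "int_comb b n c \<in> G"
proof -
  have "(\<Sum>i\<in>I. of_int (c i) * b i) \<in> G" if "finite I" "I \<subseteq> {..<n}" for I
    using that
    by (induction I rule: finite_induct)
      (auto intro!: real_subgroup_0 real_subgroup_add real_subgroup_of_int_mult assms)
  then show ?thesis by (simp add: int_comb_def)
qed

lemma int_comb_diff: "int_comb b n c - int_comb b n d = int_comb b n (\<lambda>i. c i - d i)"
  by (simp add: int_comb_def sum_subtractf algebra_simps)

lemma int_comb_add: "int_comb b n c + int_comb b n d = int_comb b n (\<lambda>i. c i + d i)"
  by (simp add: int_comb_def sum.distrib algebra_simps)

lemma int_comb_unit: "i < n \<Longrightarrow> int_comb b n (\<lambda>j. if j = i then 1 else 0) = b i"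
  by (simp add: int_comb_def if_distrib[of of_int] if_distribR cong: if_cong)
    (simp add: if_distrib[of "\<lambda>x. x * _"] cong: if_cong)

lemma int_span_base: "i < n \<Longrightarrow> b i \<in> int_span b n"
  unfolding int_span_def by (metis int_comb_unit rangeI)

lemma real_subgroup_int_span: "real_subgroup (int_span b n)"
proof -
  have "0 = int_comb b n (\<lambda>_. 0)" by (simp add: int_comb_def)
  then show ?thesis by (auto simp: real_subgroup_def int_span_def int_comb_diff)
qed

lemma int_span_subset: "real_subgroup G \<Longrightarrow> (\<And>i. i < n \<Longrightarrow> b i \<in> G) \<Longrightarrow> int_span b n \<subseteq> G"
  by (auto simp: int_span_def intro: real_subgroup_int_comb)

lemma int_indep_unique:
  assumes "int_indep b n" "int_comb b n c = int_comb b n d" "i < n"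
  shows "c i = d i"
proof -
  have "int_comb b n (\<lambda>i. c i - d i) = 0" using assms(2) by (simp flip: int_comb_diff)
  then show ?thesis using assms by (auto simp: int_indep_def)
qed

lemma int_comb_fun_upd_col:
  assumes "i < n"
  shows "int_comb (b(i := x)) n c = int_comb b n c + of_int (c i) * (x - b i)"
proof -
  have "int_comb f n c = of_int (c i) * f i + (\<Sum>j\<in>{..<n} - {i}. of_int (c j) * f j)" for f
    using assms unfolding int_comb_def by (intro sum.remove) auto
  from this[of b] this[of "b(i := x)"] show ?thesis by (simp add: algebra_simps)
qed

lemma int_comb_fun_upd_coeff:
  assumes "i < n"
  shows "int_comb b n (c(i := k)) = int_comb b n c + of_int (k - c i) * b i"
proof -
  have "int_comb b n f = of_int (f i) * b i + (\<Sum>j\<in>{..<n} - {i}. of_int (f j) * b j)" for f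
    using assms unfolding int_comb_def by (intro sum.remove) auto
  from this[of c] this[of "c(i := k)"] show ?thesis by (simp add: algebra_simps)
qed

text \<open>A shortest generating family is a basis: Euclid's algorithm on the coefficients of a
  relation, carried out by elementary moves of the generators, would produce a zero generator.\<close>

lemma int_span_has_basis: "\<exists>n\<le>k. \<exists>b. int_span b n = int_span g k \<and> int_indep b n"
proof -
  define P where "P = (\<lambda>n. \<exists>b. int_span b n = int_span g k)"
  define n where "n = (LEAST n. P n)"
  have "P k" unfolding P_def by blast
  then have n: "P n" "n \<le> k" "\<And>j. P j \<Longrightarrow> n \<le> j"
    unfolding n_def by - (erule LeastI, erule Least_le, erule Least_le)
  \<comment> \<open>\<open>N\<close> is the total size of the coefficients, the quantity that every
    Euclidean move lowers; \<open>b\<close> and \<open>c\<close> change together along the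
    induction.\<close>
  have no: False
    if "int_span b n = int_span g k" "int_comb b n c = 0" "\<exists>i<n. c i \<noteq> 0"
      and "N = (\<Sum>i<n. nat \<bar>c i\<bar>)" for N b c
    using that
  proof (induction N arbitrary: b c rule: less_induct)
    case (less N)
    from less.prems(3) obtain i where i: "i < n" "c i \<noteq> 0" by blast
    show False
    proof (cases "\<exists>j<n. j \<noteq> i \<and> c j \<noteq> 0")
      case False
      then have "int_comb b n c = of_int (c i) * b i"
        unfolding int_comb_def using i by (subst sum.remove[of _ i]) (auto intro!: sum.neutral)
      with less.prems i have bi: "b i = 0" by simp
      \<comment> \<open>With a single nonzero coefficient left, \<open>b i\<close> is zero. Moving
        the last generator \<open>b m\<close> into slot \<open>i\<close> leaves \<open>m\<close>
        generators, against the minimality of \<open>n\<close>.\<close>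
      obtain m where m: "n = Suc m" using i by (cases n) auto
      let ?b = "b(i := b m)"
      have "int_span ?b m \<subseteq> int_span b n"
        using m by (intro int_span_subset real_subgroup_int_span) (auto intro!: int_span_base)
      moreover have "b j \<in> int_span ?b m" if "j < n" for j
      proof (cases "j = i")
        case True
        then show ?thesis using bi real_subgroup_0[OF real_subgroup_int_span] by simp
      next
        case ji: False
        show ?thesis
        proof (cases "j = m")
          case True
          then have "i < m" using ji i m by auto
          then show ?thesis using int_span_base[of i m ?b] True by simp
        next
          case False
          then show ?thesis using int_span_base[of j m ?b] ji that m by simp
        qed
      qed
      then have "int_span b n \<subseteq> int_span ?b m"
        by (intro int_span_subset real_subgroup_int_span)
      ultimately have "P m" using less.prems(1) unfolding P_def by blast
      with n(3)[of m] m show False by simp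
    next
      case True
      then obtain j where j: "j < n" "j \<noteq> i" "c j \<noteq> 0" by blast
      have red: False
        if ij: "i < n" "j < n" "i \<noteq> j" "c i \<noteq> 0" "c j \<noteq> 0" "\<bar>c j\<bar> \<le> \<bar>c i\<bar>" for i j
      proof -
        \<comment> \<open>Rewriting \<open>c i * b i + c j * b j\<close> as
          \<open>(c i - s * c j) * b i + c j * (b j + s * b i)\<close> keeps the relation. The sign
          \<open>s\<close> makes the new coefficient smaller by exactly
          \<open>\<bar>c j\<bar>\<close>, while \<open>c j\<close> stays nonzero.\<close>
        define s where "s = sgn (c i) * sgn (c j)"
        have s: "\<bar>c i - s * c j\<bar> = \<bar>c i\<bar> - \<bar>c j\<bar>"
          using ij(4-6) unfolding s_def by (auto simp: sgn_if)
        let ?b = "b(j := b j + of_int s * b i)"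
        let ?c = "c(i := c i - s * c j)"
        have comb: "int_comb ?b n ?c = int_comb b n c"
          using ij by (simp add: int_comb_fun_upd_col int_comb_fun_upd_coeff algebra_simps)
        have span: "int_span ?b n = int_span b n"
        proof
          have "b j + of_int s * b i \<in> int_span b n"
            using ij by (intro real_subgroup_add real_subgroup_of_int_mult real_subgroup_int_span int_span_base)
          then show "int_span ?b n \<subseteq> int_span b n"
            by (intro int_span_subset real_subgroup_int_span) (auto intro: int_span_base)
          have bi: "b i \<in> int_span ?b n" using int_span_base[of i n ?b] ij by simp
          have "(b j + of_int s * b i) - of_int s * b i \<in> int_span ?b n"
            using int_span_base[of j n ?b] ij bi
            by (intro real_subgroup_diff real_subgroup_of_int_mult real_subgroup_int_span) simp_all
          then have "b l \<in> int_span ?b n" if "l < n" for l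
            using int_span_base[of l n ?b] that by (cases "l = j") auto
          then show "int_span b n \<subseteq> int_span ?b n"
            by (intro int_span_subset real_subgroup_int_span)
        qed
        have less: "(\<Sum>l<n. nat \<bar>?c l\<bar>) < N"
          unfolding less.prems(4)
        proof (rule sum_strict_mono_ex1)
          have "nat \<bar>?c i\<bar> < nat \<bar>c i\<bar>" using s ij by simp
          then show "\<exists>l\<in>{..<n}. nat \<bar>?c l\<bar> < nat \<bar>c l\<bar>" using ij by blast
          have "nat \<bar>?c l\<bar> \<le> nat \<bar>c l\<bar>" for l using s by (cases "l = i") auto
          then show "\<forall>l\<in>{..<n}. nat \<bar>?c l\<bar> \<le> nat \<bar>c l\<bar>" by blast
        qed simp
        have nonzero: "\<exists>l<n. ?c l \<noteq> 0" using ij by (intro exI[of _ j]) auto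
        show False
          by (rule less.IH[OF less span[unfolded less.prems(1)] comb[unfolded less.prems(2)] nonzero refl])
      qed
      show False
        using red[of i j] red[of j i] i j by linarith
    qed
  qed
  from n(1) obtain b where b: "int_span b n = int_span g k" unfolding P_def by blast
  have "int_indep b n" unfolding int_indep_def using no[OF b _ _ refl] by blast
  with b n(2) show ?thesis by blast
qed

section \<open>Groups with discrete image under finitely many additive maps\<close>

lemma additive_int_comb:
  fixes L :: "real \<Rightarrow> real"
  assumes G: "real_subgroup G" and L: "\<And>x y. x \<in> G \<Longrightarrow> y \<in> G \<Longrightarrow> L (x + y) = L x + L y"
    and b: "\<And>i. i < n \<Longrightarrow> b i \<in> G"
  shows "L (int_comb b n c) = (\<Sum>i<n. of_int (c i) * L (b i))"
proof -
  have L0: "L 0 = 0" using L[of 0 0] real_subgroup_0[OF G] by simp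
  have Lminus: "L (- x) = - L x" if "x \<in> G" for x
    using L[OF that real_subgroup_minus[OF G that]] L0 by simp
  have Lnat: "L (of_nat m * x) = of_nat m * L x" if "x \<in> G" for m x
  proof (induction m)
    case (Suc m)
    have "of_nat m * x \<in> G" using real_subgroup_of_int_mult[OF G that, of "int m"] by simp
    then show ?case using L[OF that, of "of_nat m * x"] Suc by (simp add: algebra_simps)
  qed (simp add: L0)
  have Lint: "L (of_int m * x) = of_int m * L x" if "x \<in> G" for m x
  proof (cases "m \<ge> 0")
    case True
    then show ?thesis using Lnat[OF that, of "nat m"] by simp
  next
    case False
    then show ?thesis
      using Lnat[OF real_subgroup_minus[OF G that], of "nat (- m)"] Lminus[OF that] by simp
  qed
  have "i \<le> n \<Longrightarrow> L (int_comb b i c) = (\<Sum>j<i. of_int (c j) * L (b j))" for i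
  proof (induction i)
    case (Suc i)
    have "int_comb b i c \<in> G" using Suc.prems b by (intro real_subgroup_int_comb G) auto
    moreover have "of_int (c i) * b i \<in> G" using Suc.prems b by (intro real_subgroup_of_int_mult G) auto
    ultimately have "L (int_comb b i c + of_int (c i) * b i) = L (int_comb b i c) + of_int (c i) * L (b i)"
      using L Lint b Suc.prems by auto
    then show ?case using Suc by (simp add: int_comb_def)
  qed (simp add: int_comb_def L0)
  then show ?thesis by simp
qed

text \<open>Packing: the combinations with coefficients in \<open>{0..N}\<close> number at least \<open>N ^ s\<close>, their
  images lie in \<open>O(N ^ k)\<close> unit cubes of \<open>\<real>\<^sup>k\<close>, and the cubes have fibres of bounded size.\<close>

lemma card_int_indep_le:
  fixes L :: "nat \<Rightarrow> real \<Rightarrow> real"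
  assumes G: "real_subgroup G"
    and L: "\<And>j x y. j < k \<Longrightarrow> x \<in> G \<Longrightarrow> y \<in> G \<Longrightarrow> L j (x + y) = L j x + L j y"
    and fin: "finite {x \<in> G. \<forall>j<k. \<bar>L j x\<bar> \<le> 1}"
    and b: "\<And>i. i < s \<Longrightarrow> b i \<in> G" "int_indep b s"
  shows "s \<le> k"
proof (rule ccontr)
  assume "\<not> s \<le> k"
  define S where "S = {x \<in> G. \<forall>j<k. \<bar>L j x\<bar> \<le> 1}"
  define K where "K = card S"
  \<comment> \<open>\<open>B\<close> dominates \<open>\<Sum>i<s. \<bar>L j (b i)\<bar>\<close> for
    every \<open>j\<close> at once, so combinations with coefficients in \<open>{0..N}\<close> land
    in a cube of half-side \<open>N * B\<close>.\<close>
  define B where "B = nat \<lceil>\<Sum>j<k. \<Sum>i<s. \<bar>L j (b i)\<bar>\<rceil>"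
  have B: "(\<Sum>i<s. \<bar>L j (b i)\<bar>) \<le> real B" if "j < k" for j
  proof -
    have "(\<Sum>i<s. \<bar>L j (b i)\<bar>) \<le> (\<Sum>j<k. \<Sum>i<s. \<bar>L j (b i)\<bar>)"
      using that by (intro member_le_sum) (auto intro: sum_nonneg)
    then show ?thesis unfolding B_def by linarith
  qed
  have main: "(N + 1) ^ s \<le> K * (2 * N * B + 2) ^ k" for N :: nat
  proof -
    define A where "A = PiE {..<s} (\<lambda>_. {0..int N})"
    define C where "C = PiE {..<k} (\<lambda>_. {- int (N * B) - 1..int (N * B)})"
    define f where "f = (\<lambda>c. restrict (\<lambda>j. \<lfloor>L j (int_comb b s c)\<rfloor>) {..<k})"
    have floor_mem: "\<lfloor>x\<rfloor> \<in> {- M - 1..M}" if "\<bar>x\<bar> \<le> of_int M" for x :: real and M :: int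
      using that unfolding atLeastAtMost_iff by linarith
    have fA: "f \<in> A \<rightarrow> C"
    proof
      fix c assume c: "c \<in> A"
      have LB: "\<bar>L j (int_comb b s c)\<bar> \<le> N * B" if j: "j < k" for j
      proof -
        have "\<bar>L j (int_comb b s c)\<bar> = \<bar>\<Sum>i<s. of_int (c i) * L j (b i)\<bar>"
          using additive_int_comb[OF G L[OF j] b(1)] by simp
        also have "\<dots> \<le> (\<Sum>i<s. \<bar>of_int (c i) * L j (b i)\<bar>)" by (rule sum_abs)
        also have "\<dots> \<le> (\<Sum>i<s. real N * \<bar>L j (b i)\<bar>)"
          unfolding abs_mult
        proof (intro sum_mono mult_right_mono)
          fix i assume "i \<in> {..<s}"
          then have "c i \<in> {0..int N}" by (rule PiE_mem[OF c[unfolded A_def]])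
          then show "\<bar>real_of_int (c i)\<bar> \<le> real N" by auto
        qed simp
        also have "\<dots> \<le> real N * real B"
          unfolding sum_distrib_left[symmetric] using B[OF j] by (intro mult_left_mono) auto
        finally show ?thesis by simp
      qed
      have "\<lfloor>L j (int_comb b s c)\<rfloor> \<in> {- int (N * B) - 1..int (N * B)}" if "j < k" for j
        by (rule floor_mem) (use LB[OF that] in simp)
      then show "f c \<in> C" unfolding f_def C_def by (auto simp: PiE_iff)
    qed
    have finA: "finite A" and finC: "finite C" unfolding A_def C_def by (auto intro: finite_PiE)
    have "- 1 \<le> int (N * B)" by linarith
    then have "restrict (\<lambda>_. 0) {..<k} \<in> C" unfolding C_def by (auto simp: PiE_iff)
    then have "C \<noteq> {}" by blast
    from pigeonhole_card[OF fA finA finC this]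
    obtain y where y: "card A \<le> card (f -` {y} \<inter> A) * card C" by blast
    have inj: "inj_on (int_comb b s) A"
    proof (rule inj_onI)
      fix c d assume cd: "c \<in> A" "d \<in> A" "int_comb b s c = int_comb b s d"
      show "c = d"
        using int_indep_unique[OF b(2) cd(3)] cd(1,2) unfolding A_def
        by (intro PiE_ext[of c "{..<s}" _ d]) auto
    qed
    \<comment> \<open>Combinations in one cube have the same floors. Subtracting a fixed one maps
      the fibre injectively into \<open>S\<close>, whose size does not depend on
      \<open>N\<close>.\<close>
    have fib: "card (f -` {y} \<inter> A) \<le> K"
    proof (cases "f -` {y} \<inter> A = {}")
      case False
      then obtain c0 where c0: "c0 \<in> A" "f c0 = y" by blast
      let ?h = "\<lambda>c. int_comb b s c - int_comb b s c0"
      have "inj_on ?h (f -` {y} \<inter> A)"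
        using inj by (auto simp: inj_on_def)
      moreover have "?h ` (f -` {y} \<inter> A) \<subseteq> S"
      proof clarify
        fix c assume c: "c \<in> A" "y = f c"
        have mem: "int_comb b s c \<in> G" for c by (rule real_subgroup_int_comb[OF G b(1)])
        have "\<bar>L j (?h c)\<bar> \<le> 1" if j: "j < k" for j
        proof -
          have "\<lfloor>L j (int_comb b s c)\<rfloor> = \<lfloor>L j (int_comb b s c0)\<rfloor>"
            using c c0 j unfolding f_def by (auto dest: fun_cong[of _ _ j])
          moreover have "L j (?h c) = L j (int_comb b s c) - L j (int_comb b s c0)"
            using L[OF j real_subgroup_diff[OF G mem mem] mem, of c c0 c0] by simp
          ultimately show ?thesis by linarith
        qed
        then show "?h c \<in> S" unfolding S_def using real_subgroup_diff[OF G mem mem] by blast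
      qed
      ultimately show ?thesis unfolding K_def using fin by (intro card_inj_on_le) (auto simp: S_def)
    qed simp
    have "card A = (N + 1) ^ s" unfolding A_def by (simp add: card_PiE nat_add_distrib)
    moreover have "card C = (2 * N * B + 2) ^ k"
    proof -
      have "card {- int (N * B) - 1..int (N * B)} = 2 * N * B + 2" unfolding card_atLeastAtMost_int by linarith
      then show ?thesis unfolding C_def by (subst card_PiE) (simp_all only: prod_constant card_lessThan finite_lessThan)
    qed
    ultimately show ?thesis using order_trans[OF y mult_le_mono1[OF fib]] by simp
  qed
  \<comment> \<open>This choice makes \<open>K * (2 * N * B + 2) ^ k\<close> at most
    \<open>N * (N + 1) ^ k\<close>, which is below \<open>(N + 1) ^ (k + 1)\<close>; an exponent
    \<open>s > k\<close> is then impossible.\<close>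
  define N where "N = K * (2 * B + 2) ^ k"
  have "(N + 1) ^ (k + 1) \<le> (N + 1) ^ s"
    using \<open>\<not> s \<le> k\<close> by (intro power_increasing) auto
  also have "\<dots> \<le> K * (2 * N * B + 2) ^ k" by (rule main)
  also have "\<dots> \<le> K * ((2 * B + 2) * (N + 1)) ^ k"
    by (intro mult_left_mono power_mono) (auto simp: algebra_simps)
  also have "\<dots> = N * (N + 1) ^ k" unfolding N_def power_mult_distrib by simp
  finally have "(N + 1) * (N + 1) ^ k \<le> N * (N + 1) ^ k" by simp
  then show False by simp
qed

text \<open>Adjoining \<open>x\<close> creates a relation, and independence of \<open>b\<close>
  forces \<open>x\<close> to occur in it. The sign is normalised so that division with remainder by
  \<open>k\<close> is available.\<close>

lemma int_indep_extend:
  assumes G: "real_subgroup G" and b: "\<And>i. i < s \<Longrightarrow> b i \<in> G" "int_indep b s"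
    and max: "\<And>b'. (\<forall>i<Suc s. b' i \<in> G) \<Longrightarrow> \<not> int_indep b' (Suc s)"
    and x: "x \<in> G"
  obtains k c where "k > 0" "of_int k * x = int_comb b s c"
proof -
  have "\<not> int_indep (b(s := x)) (Suc s)" by (rule max) (use b x in auto)
  then obtain c where c: "int_comb (b(s := x)) (Suc s) c = 0" "\<exists>i<Suc s. c i \<noteq> 0"
    by (auto simp: int_indep_def)
  have eq: "int_comb b s c + of_int (c s) * x = 0" using c(1) by (simp add: int_comb_def)
  have cs: "c s \<noteq> 0"
  proof
    assume "c s = 0"
    with eq have "int_comb b s c = 0" by simp
    with b(2) have "\<forall>i<s. c i = 0" by (auto simp: int_indep_def)
    with \<open>c s = 0\<close> c(2) show False by (auto simp: less_Suc_eq)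
  qed
  have neg: "int_comb b s (\<lambda>i. - c i) = - int_comb b s c"
    by (simp add: int_comb_def sum_negf)
  show ?thesis
  proof (cases "c s > 0")
    case True
    show ?thesis by (rule that[of "c s" "\<lambda>i. - c i"]) (use True eq neg in auto)
  next
    case False
    show ?thesis by (rule that[of "- c s" c]) (use False cs eq in auto)
  qed
qed

text \<open>Modulo integer combinations of a maximal independent family, every element reduces to
  one with bounded image, hence to a finite set \<open>F\<close>. So \<open>b\<close> and
  \<open>F\<close> generate \<open>G\<close>, and \<open>int_span_has_basis\<close> turns finite
  generation into a basis.\<close>

theorem discrete_image_has_basis:
  fixes L :: "nat \<Rightarrow> real \<Rightarrow> real"
  assumes G: "real_subgroup G"
    and L: "\<And>j x y. j < k \<Longrightarrow> x \<in> G \<Longrightarrow> y \<in> G \<Longrightarrow> L j (x + y) = L j x + L j y"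
    and fin: "\<And>C. finite {x \<in> G. \<forall>j<k. \<bar>L j x\<bar> \<le> C}"
  shows "\<exists>r\<le>k. \<exists>b. G = int_span b r \<and> int_indep b r"
proof -
  define P where "P = (\<lambda>s. \<exists>b. (\<forall>i<s. b i \<in> G) \<and> int_indep b s)"
  define s where "s = (GREATEST s. P s)"
  have bound: "s \<le> k" if "P s" for s
    using that card_int_indep_le[OF G L fin] unfolding P_def by blast
  have "P 0" unfolding P_def by (auto simp: int_indep_def)
  have "P s" unfolding s_def by (rule GreatestI_nat[of P 0 k]) (use \<open>P 0\<close> bound in auto)
  have max: "t \<le> s" if "P t" for t
    unfolding s_def by (rule Greatest_le_nat[of P t k]) (use that bound in auto)
  from \<open>P s\<close> obtain b where b: "\<And>i. i < s \<Longrightarrow> b i \<in> G" "int_indep b s" unfolding P_def by blast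
  have max': "\<not> int_indep b' (Suc s)" if "\<forall>i<Suc s. b' i \<in> G" for b'
    using max[of "Suc s"] that unfolding P_def by (meson Suc_n_not_le_n)
  define C where "C = (\<Sum>j<k. \<Sum>i<s. \<bar>L j (b i)\<bar>)"
  define F where "F = {x \<in> G. \<forall>j<k. \<bar>L j x\<bar> \<le> C}"
  have "finite F" unfolding F_def by (rule fin)
  then obtain f where f: "F = f ` {..<card F}"
    by (metis atLeast0LessThan ex_bij_betw_nat_finite bij_betw_imp_surj_on)
  define g where "g = (\<lambda>i. if i < s then b i else f (i - s))"
  define n where "n = s + card F"
  have "F \<subseteq> G" unfolding F_def by blast
  have gG: "g i \<in> G" if "i < n" for i
    using that b f \<open>F \<subseteq> G\<close> unfolding g_def n_def by auto
  have "x \<in> int_span g n" if x: "x \<in> G" for x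
  proof -
    obtain m c where m: "m > 0" "of_int m * x = int_comb b s c"
      using int_indep_extend[OF G b max' x] by blast
    \<comment> \<open>\<open>x\<close> has the rational coefficients \<open>c i / m\<close> with
      respect to \<open>b\<close>, and \<open>q\<close> takes their integer parts. The coefficients
      of \<open>x - q\<close> lie in \<open>[0, 1)\<close>, so its images are bounded by
      \<open>C\<close>, independently of \<open>x\<close>.\<close>
    define q where "q = int_comb b s (\<lambda>i. c i div m)"
    have qG: "q \<in> G" unfolding q_def by (rule real_subgroup_int_comb[OF G b(1)])
    have my: "of_int m * (x - q) = int_comb b s (\<lambda>i. c i mod m)"
    proof -
      have "of_int m * q = int_comb b s (\<lambda>i. m * (c i div m))"
        unfolding q_def int_comb_def sum_distrib_left by (simp add: mult.assoc)
      then show ?thesis using m(2)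
        by (simp add: right_diff_distrib int_comb_diff minus_mult_div_eq_mod)
    qed
    have "\<bar>L j (x - q)\<bar> \<le> C" if j: "j < k" for j
    proof -
      have xq: "x - q \<in> G" by (rule real_subgroup_diff[OF G x qG])
      have "int_comb (\<lambda>_. x - q) 1 (\<lambda>_. m) = of_int m * (x - q)" by (simp add: int_comb_def)
      then have "of_int m * L j (x - q) = L j (of_int m * (x - q))"
        using additive_int_comb[OF G L[OF j], of 1 "\<lambda>_. x - q" "\<lambda>_. m"] xq by simp
      also have "\<dots> = (\<Sum>i<s. of_int (c i mod m) * L j (b i))"
        unfolding my by (rule additive_int_comb[OF G L[OF j] b(1)])
      finally have "of_int m * \<bar>L j (x - q)\<bar> = \<bar>\<Sum>i<s. of_int (c i mod m) * L j (b i)\<bar>"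
        using m(1) by (metis abs_mult abs_of_pos of_int_0_less_iff)
      also have "\<dots> \<le> (\<Sum>i<s. \<bar>of_int (c i mod m) * L j (b i)\<bar>)" by (rule sum_abs)
      also have "\<dots> \<le> (\<Sum>i<s. of_int m * \<bar>L j (b i)\<bar>)"
        unfolding abs_mult
      proof (intro sum_mono mult_right_mono)
        fix i
        have "\<bar>c i mod m\<bar> \<le> m" using m(1) by (simp add: order_less_imp_le)
        then show "\<bar>real_of_int (c i mod m)\<bar> \<le> real_of_int m" by linarith
      qed simp
      also have "\<dots> = of_int m * (\<Sum>i<s. \<bar>L j (b i)\<bar>)" by (simp add: sum_distrib_left)
      finally have "\<bar>L j (x - q)\<bar> \<le> (\<Sum>i<s. \<bar>L j (b i)\<bar>)" using m(1) by simp
      also have "\<dots> \<le> C"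
        unfolding C_def using j by (intro member_le_sum) (auto intro: sum_nonneg)
      finally show ?thesis .
    qed
    then have "x - q \<in> F" unfolding F_def using real_subgroup_diff[OF G x qG] by blast
    then obtain i where i: "i < card F" "x - q = f i" using f by auto
    have "x - q \<in> int_span g n"
      using int_span_base[of "s + i" n g] i unfolding g_def n_def by simp
    moreover have "q \<in> int_span g n"
      unfolding q_def
    proof (intro real_subgroup_int_comb real_subgroup_int_span)
      fix i assume "i < s"
      then show "b i \<in> int_span g n" using int_span_base[of i n g] by (simp add: g_def n_def)
    qed
    ultimately show ?thesis
      using real_subgroup_add[OF real_subgroup_int_span, of "x - q" g n q] by simp
  qed
  moreover have "int_span g n \<subseteq> G" by (rule int_span_subset[OF G gG])
  ultimately have Gg: "G = int_span g n" by blast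
  obtain r b' where r: "int_span b' r = int_span g n" "int_indep b' r"
    using int_span_has_basis by blast
  \<comment> \<open>The generating family has \<open>s + card F\<close> members, so the bound comes
    from applying the packing estimate to the extracted basis itself.\<close>
  have "r \<le> k" using Gg r int_span_base[of _ r b'] by (intro card_int_indep_le[OF G L fin, of r b']) auto
  with Gg r show ?thesis by metis
qed

section \<open>Simultaneous triangularisation\<close>

text \<open>The vector \<open>p(B) v\<close>, by Horner's scheme.\<close>

definition poly_orbit :: "complex mat \<Rightarrow> complex vec \<Rightarrow> complex Polynomial.poly \<Rightarrow> complex vec"
  where "poly_orbit B v p = fold_coeffs (\<lambda>a w. a \<cdot>\<^sub>v v + B *\<^sub>v w) p (0\<^sub>v (dim_vec v))"

context
  fixes B :: "complex mat" and v :: "complex vec" and n :: nat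
  assumes B: "B \<in> carrier_mat n n" and v: "v \<in> carrier_vec n"
begin

lemma poly_orbit_0: "poly_orbit B v 0 = 0\<^sub>v n"
  using v by (simp add: poly_orbit_def)

lemma poly_orbit_pCons: "poly_orbit B v (pCons a p) = a \<cdot>\<^sub>v v + B *\<^sub>v poly_orbit B v p"
proof (cases "a = 0 \<and> p = 0")
  case True
  have "B *\<^sub>v 0\<^sub>v n = 0\<^sub>v n" using B by (intro eq_vecI) auto
  then show ?thesis using True v by (auto simp: poly_orbit_0)
next
  case False
  then show ?thesis by (auto simp: poly_orbit_def fold_coeffs_pCons_coeff_not_0_eq fold_coeffs_pCons_not_0_0_eq)
qed

lemma poly_orbit_carrier: "poly_orbit B v p \<in> carrier_vec n"
  by (induction p) (use B v in \<open>auto simp: poly_orbit_0 poly_orbit_pCons\<close>)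

text \<open>Evaluation is linear in the polynomial and \<open>pCons 0\<close> applies
  \<open>B\<close> once more, so this is \<open>(B - e) p(B) v\<close>: a root of an annihilating
  polynomial becomes an eigenvalue.\<close>

lemma poly_orbit_linear_factor:
  "poly_orbit B v ([:- e, 1:] * p) = B *\<^sub>v poly_orbit B v p - e \<cdot>\<^sub>v poly_orbit B v p"
proof -
  have add: "poly_orbit B v (p + q) = poly_orbit B v p + poly_orbit B v q" for p q
  proof (induction p q rule: poly_induct2)
    case (pCons a p b q)
    have "B *\<^sub>v (poly_orbit B v p + poly_orbit B v q) = B *\<^sub>v poly_orbit B v p + B *\<^sub>v poly_orbit B v q"
      by (rule mult_add_distrib_mat_vec[OF B poly_orbit_carrier poly_orbit_carrier])
    then show ?case
      using v B poly_orbit_carrier[of p] poly_orbit_carrier[of q] pCons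
      by (intro eq_vecI) (auto simp: poly_orbit_pCons algebra_simps)
  qed (simp add: poly_orbit_0)
  have smult: "poly_orbit B v (Polynomial.smult c p) = c \<cdot>\<^sub>v poly_orbit B v p" for c p
  proof (induction p)
    case (pCons a p)
    have "B *\<^sub>v (c \<cdot>\<^sub>v poly_orbit B v p) = c \<cdot>\<^sub>v (B *\<^sub>v poly_orbit B v p)"
      by (rule mult_mat_vec[OF B poly_orbit_carrier])
    then show ?case
      using v B poly_orbit_carrier[of p] pCons
      by (intro eq_vecI) (auto simp: poly_orbit_pCons algebra_simps)
  qed (auto simp: poly_orbit_0 intro!: eq_vecI)
  have eq: "poly_orbit B v ([:- e, 1:] * p) = (- e) \<cdot>\<^sub>v poly_orbit B v p + poly_orbit B v (pCons 0 p)"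
    unfolding smult[symmetric] add[symmetric] by simp
  show ?thesis
    unfolding eq using v B poly_orbit_carrier[of p]
    by (intro eq_vecI) (auto simp: poly_orbit_pCons)
qed

text \<open>The orbit vector is the matrix with columns \<open>B^j v\<close> applied to the
  coefficients, a form in which a determinant can detect an annihilating polynomial.\<close>

lemma poly_orbit_index:
  assumes "r < n"
  shows "poly_orbit B v (Poly cs) $v r = (\<Sum>j<length cs. cs ! j * (((*\<^sub>v) B ^^ j) v) $v r)"
  using assms
proof (induction cs arbitrary: r)
  case (Cons c cs)
  have car: "((*\<^sub>v) B ^^ j) v \<in> carrier_vec n" for j
    by (induction j) (use B v in auto)
  have mv: "(B *\<^sub>v w) $v r = (\<Sum>s<n. B $$ (r, s) * w $v s)" if "w \<in> carrier_vec n" for w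
    using B Cons.prems that by (simp add: scalar_prod_def atLeast0LessThan)
  have "(B *\<^sub>v poly_orbit B v (Poly cs)) $v r
      = (\<Sum>s<n. B $$ (r, s) * (\<Sum>j<length cs. cs ! j * (((*\<^sub>v) B ^^ j) v) $v s))"
    by (simp add: mv poly_orbit_carrier Cons.IH)
  also have "\<dots> = (\<Sum>j<length cs. cs ! j * (\<Sum>s<n. B $$ (r, s) * (((*\<^sub>v) B ^^ j) v) $v s))"
    unfolding sum_distrib_left by (subst sum.swap) (simp add: mult_ac)
  also have "\<dots> = (\<Sum>j<length cs. cs ! j * (((*\<^sub>v) B ^^ Suc j) v) $v r)"
    by (simp add: mv car)
  finally have "(B *\<^sub>v poly_orbit B v (Poly cs)) $v r = \<dots>" .
  then have "poly_orbit B v (Poly (c # cs)) $v r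
      = c * v $v r + (\<Sum>j<length cs. cs ! j * (((*\<^sub>v) B ^^ Suc j) v) $v r)"
    using Cons.prems v B by (simp add: poly_orbit_pCons)
  also have "\<dots> = (\<Sum>j<Suc (length cs). (c # cs) ! j * (((*\<^sub>v) B ^^ j) v) $v r)"
    unfolding sum.lessThan_Suc_shift by simp
  finally show ?case by simp
qed (simp add: poly_orbit_0)

lemma poly_orbit_vanishes: "\<exists>p. p \<noteq> 0 \<and> poly_orbit B v p = 0\<^sub>v n"
proof -
  \<comment> \<open>The \<open>n + 1\<close> vectors \<open>B^j v\<close> give \<open>n\<close>
    rows; a zero row makes the matrix square and singular, and a kernel vector supplies the
    coefficients.\<close>
  define M where "M = mat (n + 1) (n + 1) (\<lambda>(r, j). if r < n then (((*\<^sub>v) B ^^ j) v) $v r else 0)"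
  have M: "M \<in> carrier_mat (n + 1) (n + 1)" unfolding M_def by simp
  have "det M = 0"
  proof -
    have "M = mat\<^sub>r (n + 1) (n + 1) (\<lambda>i. if i = n then 0\<^sub>v (n + 1) else Matrix.row M i)"
      by (rule eq_matI) (auto simp: M_def)
    then show ?thesis using det_row_0[of n "n + 1" "Matrix.row M"] M by auto
  qed
  then obtain c where c: "c \<in> carrier_vec (n + 1)" "c \<noteq> 0\<^sub>v (n + 1)" "M *\<^sub>v c = 0\<^sub>v (n + 1)"
    using det_0_iff_vec_prod_zero[OF M] by auto
  define p where "p = Poly (list_of_vec c)"
  have "poly_orbit B v p $v r = 0" if r: "r < n" for r
  proof -
    have "poly_orbit B v p $v r = (\<Sum>j<n + 1. c $v j * (((*\<^sub>v) B ^^ j) v) $v r)"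
      unfolding p_def using c(1) by (simp add: poly_orbit_index[OF r])
    also have "\<dots> = (M *\<^sub>v c) $v r"
      using r c(1) M by (auto simp: scalar_prod_def M_def atLeast0LessThan mult.commute intro!: sum.cong)
    finally show ?thesis using r c(3) by simp
  qed
  then have "poly_orbit B v p = 0\<^sub>v n"
    using poly_orbit_carrier[of p] by (intro eq_vecI) auto
  moreover have "p \<noteq> 0"
  proof
    assume "p = 0"
    then have "Polynomial.coeff p j = 0" for j by simp
    then have "c $v j = 0" if "j < n + 1" for j
      using that c(1) unfolding p_def
      by (metis carrier_vecD coeff_Poly_eq length_list_of_vec list_of_vec_index nth_default_nth)
    then have "c = 0\<^sub>v (n + 1)" using c(1) by (intro eq_vecI) auto
    with c(2) show False ..
  qed
  ultimately show ?thesis by blast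
qed

text \<open>An annihilating polynomial of least degree has a factor \<open>X - e\<close>. By
  minimality the cofactor does not annihilate \<open>v\<close>, and the vector it produces is killed
  by \<open>B - e\<close>. The form \<open>p(B) v\<close> of the eigenvector is what makes it usable
  for commuting matrices.\<close>

lemma poly_orbit_eigenvector:
  assumes "v \<noteq> 0\<^sub>v n"
  shows "\<exists>p e. poly_orbit B v p \<noteq> 0\<^sub>v n \<and> B *\<^sub>v poly_orbit B v p = e \<cdot>\<^sub>v poly_orbit B v p"
proof -
  define P where "P = (\<lambda>p. p \<noteq> 0 \<and> poly_orbit B v p = 0\<^sub>v n)"
  obtain p where p: "P p" and min: "\<And>q. P q \<Longrightarrow> Polynomial.degree p \<le> Polynomial.degree q"
    using poly_orbit_vanishes ex_has_least_nat[of P _ Polynomial.degree] unfolding P_def by blast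
  have "Polynomial.degree p \<noteq> 0"
  proof
    assume "Polynomial.degree p = 0"
    then obtain a where a: "p = [:a:]" by (rule degree_eq_zeroE)
    have "B *\<^sub>v 0\<^sub>v n = 0\<^sub>v n" using B by (intro eq_vecI) auto
    then have "a \<cdot>\<^sub>v v = 0\<^sub>v n" "a \<noteq> 0"
      using p a v unfolding P_def by (auto simp: poly_orbit_pCons poly_orbit_0)
    then have "v $v i = 0" if "i < n" for i
      using that v by (metis index_smult_vec(1) index_zero_vec(1) carrier_vecD mult_eq_0_iff)
    then show False using assms v by (auto intro: eq_vecI)
  qed
  then obtain e where "poly p e = 0"
    using fundamental_theorem_of_algebra[of p] constant_degree[of p] by auto
  then obtain q where q: "p = [:- e, 1:] * q" unfolding poly_eq_0_iff_dvd by (auto elim: dvdE)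
  have "q \<noteq> 0" using p q unfolding P_def by auto
  then have "Polynomial.degree p = Suc (Polynomial.degree q)"
    unfolding q by (subst degree_mult_eq) auto
  with min[of q] \<open>q \<noteq> 0\<close> have nz: "poly_orbit B v q \<noteq> 0\<^sub>v n" unfolding P_def by auto
  have eq: "B *\<^sub>v poly_orbit B v q - e \<cdot>\<^sub>v poly_orbit B v q = 0\<^sub>v n"
    using p unfolding P_def q poly_orbit_linear_factor by blast
  have "B *\<^sub>v poly_orbit B v q = e \<cdot>\<^sub>v poly_orbit B v q"
  proof (rule eq_vecI)
    fix i assume "i < dim_vec (e \<cdot>\<^sub>v poly_orbit B v q)"
    then have "i < n" using poly_orbit_carrier[of q] by simp
    then show "(B *\<^sub>v poly_orbit B v q) $v i = (e \<cdot>\<^sub>v poly_orbit B v q) $v i"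
      using arg_cong[OF eq, of "\<lambda>w. w $v i"] poly_orbit_carrier[of q] B by simp
  qed (use B poly_orbit_carrier[of q] in auto)
  with nz show ?thesis by blast
qed

end

section \<open>Commuting families of matrices\<close>

text \<open>To include one more matrix, \<open>v\<close> is replaced by an eigenvector
  \<open>p(A i) v\<close>. Each earlier \<open>A j\<close> commutes with \<open>A i\<close>, so it
  acts on this vector by the same scalar as on \<open>v\<close>.\<close>

lemma common_eigenvector:
  fixes A :: "'i \<Rightarrow> complex mat"
  assumes "finite I" "\<And>i. i \<in> I \<Longrightarrow> A i \<in> carrier_mat n n"
    and "\<And>i j. i \<in> I \<Longrightarrow> j \<in> I \<Longrightarrow> A i * A j = A j * A i" and "n \<noteq> 0"
  shows "\<exists>v\<in>carrier_vec n. v \<noteq> 0\<^sub>v n \<and> (\<forall>i\<in>I. \<exists>c. A i *\<^sub>v v = c \<cdot>\<^sub>v v)"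
  using assms(1-3)
proof (induction I rule: finite_induct)
  case empty
  have "unit_vec n 0 \<noteq> (0\<^sub>v n :: complex vec)"
    using \<open>n \<noteq> 0\<close> by (metis gr0I index_unit_vec(2) index_zero_vec(1) zero_neq_one)
  then show ?case by (intro bexI[of _ "unit_vec n 0"]) auto
next
  case (insert i I)
  then obtain v where v: "v \<in> carrier_vec n" "v \<noteq> 0\<^sub>v n" "\<And>j. j \<in> I \<Longrightarrow> \<exists>c. A j *\<^sub>v v = c \<cdot>\<^sub>v v"
    by (metis insertI2)
  have Ai: "A i \<in> carrier_mat n n" using insert.prems by blast
  obtain p e where p: "poly_orbit (A i) v p \<noteq> 0\<^sub>v n"
    "A i *\<^sub>v poly_orbit (A i) v p = e \<cdot>\<^sub>v poly_orbit (A i) v p"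
    using poly_orbit_eigenvector[OF Ai v(1,2)] by blast
  have "A j *\<^sub>v poly_orbit (A i) v q = c \<cdot>\<^sub>v poly_orbit (A i) v q"
    if j: "j \<in> I" and c: "A j *\<^sub>v v = c \<cdot>\<^sub>v v" for j c q
  proof (induction q)
    case 0
    have Aj: "A j \<in> carrier_mat n n" using insert.prems j by blast
    show ?case using Aj unfolding poly_orbit_0[OF Ai v(1)] by (intro eq_vecI) auto
  next
    case (pCons a q)
    let ?w = "poly_orbit (A i) v q"
    have Aj: "A j \<in> carrier_mat n n" using insert.prems j by blast
    have w: "?w \<in> carrier_vec n" by (rule poly_orbit_carrier[OF Ai v(1)])
    have Aw: "A i *\<^sub>v ?w \<in> carrier_vec n" using Ai w by simp
    have "A j *\<^sub>v (A i *\<^sub>v ?w) = (A j * A i) *\<^sub>v ?w"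
      by (rule assoc_mult_mat_vec[OF Aj Ai w, symmetric])
    also have "\<dots> = (A i * A j) *\<^sub>v ?w" using insert.prems(2)[of j i] j by simp
    also have "\<dots> = A i *\<^sub>v (A j *\<^sub>v ?w)" by (rule assoc_mult_mat_vec[OF Ai Aj w])
    also have "\<dots> = c \<cdot>\<^sub>v (A i *\<^sub>v ?w)" unfolding pCons.IH by (rule mult_mat_vec[OF Ai w])
    finally have 1: "A j *\<^sub>v (A i *\<^sub>v ?w) = c \<cdot>\<^sub>v (A i *\<^sub>v ?w)" .
    have 2: "A j *\<^sub>v (a \<cdot>\<^sub>v v) = c \<cdot>\<^sub>v (a \<cdot>\<^sub>v v)"
      unfolding mult_mat_vec[OF Aj v(1)] c by (simp add: smult_smult_assoc mult.commute)
    have "A j *\<^sub>v (a \<cdot>\<^sub>v v + A i *\<^sub>v ?w) = A j *\<^sub>v (a \<cdot>\<^sub>v v) + A j *\<^sub>v (A i *\<^sub>v ?w)"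
      using v(1) Aw by (intro mult_add_distrib_mat_vec[OF Aj]) auto
    also have "\<dots> = c \<cdot>\<^sub>v (a \<cdot>\<^sub>v v + A i *\<^sub>v ?w)"
      unfolding 1 2 using v(1) Aw by (intro smult_add_distrib_vec[symmetric]) auto
    finally show ?case unfolding poly_orbit_pCons[OF Ai v(1)] .
  qed
  then show ?case
    using p v(3) poly_orbit_carrier[OF Ai v(1), of p]
    by (intro bexI[of _ "poly_orbit (A i) v p"]) (auto, metis)
qed

text \<open>Gram-Schmidt keeps the first vector of a completed basis, and for orthogonal columns the
  inverse is explicit.\<close>

lemma invertible_mat_with_first_column:
  fixes v :: "complex vec"
  assumes v: "v \<in> carrier_vec n" "v \<noteq> 0\<^sub>v n" and n: "n \<noteq> 0"
  obtains W W' where "W \<in> carrier_mat n n" "W' \<in> carrier_mat n n"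
    "W * W' = 1\<^sub>m n" "W' * W = 1\<^sub>m n" "col W 0 = v"
proof -
  interpret cof_vec_space n "TYPE(complex)" .
  define b where "b = basis_completion v"
  define ws where "ws = gram_schmidt n b"
  define W where "W = mat_of_cols n ws"
  define W' where "W' = corthogonal_inv W"
  note b = basis_completion[OF v, folded b_def]
  obtain vs where bv: "b = v # vs" using b(6,7) n by (cases b) auto
  have ws: "set ws \<subseteq> carrier_vec n" "corthogonal ws" "length ws = n"
    using gram_schmidt_result[OF b(2,4,5) refl, folded ws_def] b(6) by auto
  have hd: "hd ws = v" using gram_schmidt_hd[OF v(1), of vs] by (simp add: ws_def bv)
  have W: "W \<in> carrier_mat n n" using ws unfolding W_def by auto
  have W': "W' \<in> carrier_mat n n"
    unfolding W'_def corthogonal_inv_def using W by (auto simp: mat_of_rows_def)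
  have W'W: "W' * W = 1\<^sub>m n"
    using corthogonal_inv_result[OF orthogonal_mat_of_cols[OF ws], folded W_def W'_def] W'
    unfolding inverts_mat_def by auto
  have WW': "W * W' = 1\<^sub>m n" by (rule mat_mult_left_right_inverse[OF W' W W'W])
  have "ws ! 0 = v" using hd ws(3) n by (metis hd_conv_nth length_0_conv)
  then have "col W 0 = v" unfolding W_def using ws(3) n v(1) by (subst col_mat_of_cols) auto
  with W W' WW' W'W show ?thesis by (rule that)
qed

text \<open>Deflation: a common eigenvector as first column splits a \<open>1 \<times> 1\<close>
  block off all matrices at once, and the induction continues on the lower right blocks.\<close>

theorem simultaneous_upper_triangular:
  fixes A :: "'i \<Rightarrow> complex mat"
  assumes I: "finite I" and A: "\<And>i. i \<in> I \<Longrightarrow> A i \<in> carrier_mat n n"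
    and comm: "\<And>i j. i \<in> I \<Longrightarrow> j \<in> I \<Longrightarrow> A i * A j = A j * A i"
  shows "\<exists>P\<in>carrier_mat n n. \<exists>Q\<in>carrier_mat n n. P * Q = 1\<^sub>m n \<and> Q * P = 1\<^sub>m n
    \<and> (\<forall>i\<in>I. upper_triangular (Q * A i * P))"
  using A comm
proof (induction n arbitrary: A)
  case 0
  then show ?case
    by (intro bexI[of _ "1\<^sub>m 0"]) (auto intro!: upper_triangularI)
next
  case (Suc m)
  obtain v where v: "v \<in> carrier_vec (Suc m)" "v \<noteq> 0\<^sub>v (Suc m)"
    and ev: "\<And>i. i \<in> I \<Longrightarrow> \<exists>c. A i *\<^sub>v v = c \<cdot>\<^sub>v v"
    using common_eigenvector[of I A "Suc m", OF I Suc.prems] by auto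
  obtain W W' where W: "W \<in> carrier_mat (Suc m) (Suc m)" and W': "W' \<in> carrier_mat (Suc m) (Suc m)"
    and WW': "W * W' = 1\<^sub>m (Suc m)" and W'W: "W' * W = 1\<^sub>m (Suc m)" and colW: "col W 0 = v"
    using invertible_mat_with_first_column[OF v] by blast
  have block: "\<exists>E R D. E \<in> carrier_mat 1 1 \<and> R \<in> carrier_mat 1 m \<and> D \<in> carrier_mat m m
      \<and> W' * A i * W = four_block_mat E R (0\<^sub>m m 1) D" if i: "i \<in> I" for i
  proof -
    note Ai = Suc.prems(1)[OF i]
    obtain c where c: "A i *\<^sub>v v = c \<cdot>\<^sub>v v" using ev[OF i] by blast
    have AiW: "W' * A i \<in> carrier_mat (Suc m) (Suc m)" using Ai W' by simp
    have X: "W' * A i * W \<in> carrier_mat (Suc m) (Suc m)" using AiW W by simp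
    have e0: "W' *\<^sub>v v = col (W' * W) 0"
      using col_mult2[OF W' W, of 0] colW by simp
    have "col (W' * A i * W) 0 = (W' * A i) *\<^sub>v v"
      using col_mult2[OF AiW W, of 0] colW by simp
    also have "\<dots> = W' *\<^sub>v (c \<cdot>\<^sub>v v)" unfolding c[symmetric] by (rule assoc_mult_mat_vec[OF W' Ai v(1)])
    also have "\<dots> = c \<cdot>\<^sub>v col (1\<^sub>m (Suc m)) 0"
      unfolding mult_mat_vec[OF W' v(1)] e0 W'W ..
    finally have col0: "col (W' * A i * W) 0 = c \<cdot>\<^sub>v col (1\<^sub>m (Suc m)) 0" .
    have zero: "(W' * A i * W) $$ (Suc r, 0) = 0" if "r < m" for r
    proof -
      have "(W' * A i * W) $$ (Suc r, 0) = col (W' * A i * W) 0 $v Suc r"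
        using that X by (intro index_col[symmetric]) auto
      then show ?thesis unfolding col0 using that by simp
    qed
    obtain E R Z D where spl: "split_block (W' * A i * W) 1 1 = (E, R, Z, D)"
      by (cases "split_block (W' * A i * W) 1 1") auto
    note sb = split_block[OF spl, of m m]
    have dims: "dim_row (W' * A i * W) = 1 + m" "dim_col (W' * A i * W) = 1 + m" using X by auto
    have "Z = 0\<^sub>m m 1"
    proof (rule eq_matI)
      fix r s assume rs: "r < dim_row (0\<^sub>m m 1)" "s < dim_col (0\<^sub>m m 1)"
      have "Z $$ (r, s) = (W' * A i * W) $$ (Suc r, 0)"
        using spl rs dims unfolding split_block_def by (auto simp: Let_def)
      then show "Z $$ (r, s) = 0\<^sub>m m 1 $$ (r, s)" using zero rs by simp
    qed (use sb(3)[OF dims] in auto)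
    then show ?thesis using sb[OF dims] by blast
  qed
  then obtain E R D where E: "\<And>i. i \<in> I \<Longrightarrow> E i \<in> carrier_mat 1 1"
    and R: "\<And>i. i \<in> I \<Longrightarrow> R i \<in> carrier_mat 1 m"
    and D: "\<And>i. i \<in> I \<Longrightarrow> D i \<in> carrier_mat m m"
    and X: "\<And>i. i \<in> I \<Longrightarrow> W' * A i * W = four_block_mat (E i) (R i) (0\<^sub>m m 1) (D i)"
    by metis
  have prod: "(W' * A i * W) * (W' * A j * W) = W' * (A i * A j) * W" if "i \<in> I" "j \<in> I" for i j
  proof -
    note Ai = Suc.prems(1)[OF that(1)] and Aj = Suc.prems(1)[OF that(2)]
    have "(W' * A i * W) * (W' * A j * W) = W' * A i * (W * (W' * A j * W))"
      using W W' Ai Aj by (intro assoc_mult_mat) auto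
    also have "W * (W' * A j * W) = (W * W') * (A j * W)"
      using W W' Aj by (simp add: assoc_mult_mat[of _ "Suc m" "Suc m" _ "Suc m" _ "Suc m"])
    also have "\<dots> = A j * W" unfolding WW' using Aj W by simp
    also have "W' * A i * (A j * W) = W' * (A i * A j) * W"
      using W W' Ai Aj by (simp add: assoc_mult_mat[of _ "Suc m" "Suc m" _ "Suc m" _ "Suc m"])
    finally show ?thesis .
  qed
  \<comment> \<open>As the lower left blocks vanish, the lower right block of a product is the
    product of the lower right blocks, so commutativity is inherited.\<close>
  have "D i * D j = D j * D i" if ij: "i \<in> I" "j \<in> I" for i j
  proof -
    have blk: "(W' * A i * W) * (W' * A j * W) = four_block_mat (E i * E j + R i * 0\<^sub>m m 1)
        (E i * R j + R i * D j) (0\<^sub>m m 1 * E j + D i * 0\<^sub>m m 1) (0\<^sub>m m 1 * R j + D i * D j)"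
      if ij: "i \<in> I" "j \<in> I" for i j
      unfolding X[OF ij(1)] X[OF ij(2)]
      by (rule mult_four_block_mat[OF E[OF ij(1)] R[OF ij(1)] _ D[OF ij(1)] E[OF ij(2)] R[OF ij(2)] _ D[OF ij(2)]]) auto
    have entry: "((W' * A i * W) * (W' * A j * W)) $$ (Suc r, Suc s) = (D i * D j) $$ (r, s)"
      if ij: "i \<in> I" "j \<in> I" and rs: "r < m" "s < m" for i j r s
      unfolding blk[OF ij] using E[OF ij(1)] E[OF ij(2)] R[OF ij(1)] R[OF ij(2)] D[OF ij(1)] D[OF ij(2)] rs
      by (subst index_mat_four_block) auto
    have "(W' * A i * W) * (W' * A j * W) = (W' * A j * W) * (W' * A i * W)"
      using prod[OF ij] prod[OF ij(2,1)] Suc.prems(2)[OF ij] by simp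
    then show ?thesis
      using entry[OF ij] entry[OF ij(2,1)] D[OF ij(1)] D[OF ij(2)] by (intro eq_matI) auto
  qed
  then obtain P Q where P: "P \<in> carrier_mat m m" and Q: "Q \<in> carrier_mat m m"
    and PQ: "P * Q = 1\<^sub>m m" and QP: "Q * P = 1\<^sub>m m"
    and ut: "\<And>i. i \<in> I \<Longrightarrow> upper_triangular (Q * D i * P)"
    using Suc.IH[of D, OF D] by blast
  \<comment> \<open>Extending by 1 keeps the eigenvector that was split off in the first
    column.\<close>
  let ?P = "four_block_mat (1\<^sub>m 1) (0\<^sub>m 1 m) (0\<^sub>m m 1) P"
  let ?Q = "four_block_mat (1\<^sub>m 1) (0\<^sub>m 1 m) (0\<^sub>m m 1) Q"
  have one: "(1\<^sub>m 1 :: complex mat) \<in> carrier_mat 1 1" "(0\<^sub>m 1 m :: complex mat) \<in> carrier_mat 1 m"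
    "(0\<^sub>m m 1 :: complex mat) \<in> carrier_mat m 1" by auto
  have P4: "?P \<in> carrier_mat (Suc m) (Suc m)" and Q4: "?Q \<in> carrier_mat (Suc m) (Suc m)"
    using four_block_carrier_mat[OF one(1) P] four_block_carrier_mat[OF one(1) Q] by auto
  have PQ4: "?P * ?Q = 1\<^sub>m (Suc m)"
    unfolding mult_four_block_mat[OF one P one Q] PQ using P Q by auto
  have QP4: "?Q * ?P = 1\<^sub>m (Suc m)"
    unfolding mult_four_block_mat[OF one Q one P] QP using P Q by auto
  have "upper_triangular (?Q * W' * A i * (W * ?P))" if i: "i \<in> I" for i
  proof -
    note Ai = Suc.prems(1)[OF i]
    note Ei = E[OF i] and Ri = R[OF i] and Di = D[OF i]
    have RP: "R i * P \<in> carrier_mat 1 m" and DP: "D i * P \<in> carrier_mat m m" using Ri Di P by auto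
    have "?Q * W' * A i * (W * ?P) = ?Q * (W' * A i * W) * ?P"
      using W W' Ai P4 Q4 by (simp add: assoc_mult_mat[of _ "Suc m" "Suc m" _ "Suc m" _ "Suc m"])
    also have "\<dots> = four_block_mat (E i) (R i) (0\<^sub>m m 1) (Q * D i) * ?P"
      unfolding X[OF i] mult_four_block_mat[OF one Q Ei Ri one(3) Di] using Ei Ri Di Q by simp
    also have "\<dots> = four_block_mat (E i) (R i * P) (0\<^sub>m m 1) (Q * D i * P)"
      unfolding mult_four_block_mat[OF Ei Ri one(3) mult_carrier_mat[OF Q Di] one P]
      using Ei Ri Di Q P by simp
    finally have eq: "?Q * W' * A i * (W * ?P) = \<dots>" .
    have "upper_triangular (E i)" using Ei by (intro upper_triangularI) auto
    then show ?thesis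
      unfolding eq using Ei Q Di P by (intro upper_triangular_four_block[of _ 1 _ m] ut[OF i]) auto
  qed
  moreover have "W * ?P * (?Q * W') = 1\<^sub>m (Suc m)"
  proof -
    have "W * ?P * (?Q * W') = W * (?P * ?Q) * W'"
      using W W' P4 Q4 by (simp add: assoc_mult_mat[of _ "Suc m" "Suc m" _ "Suc m" _ "Suc m"])
    then show ?thesis unfolding PQ4 using W WW' by simp
  qed
  moreover have "?Q * W' * (W * ?P) = 1\<^sub>m (Suc m)"
  proof -
    have "?Q * W' * (W * ?P) = ?Q * (W' * W) * ?P"
      using W W' P4 Q4 by (simp add: assoc_mult_mat[of _ "Suc m" "Suc m" _ "Suc m" _ "Suc m"])
    then show ?thesis unfolding W'W right_mult_one_mat[OF Q4] QP4 .
  qed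
  ultimately show ?case
    using W W' P4 Q4 by (intro bexI[of _ "W * ?P"] bexI[of _ "?Q * W'"]) auto
qed

section \<open>Units of the ring of multipliers\<close>

text \<open>The choice is meaningful only for \<open>x\<close> in the span; for an independent
  family the values at indices below \<open>n\<close> are then determined.\<close>

definition int_coord :: "(nat \<Rightarrow> real) \<Rightarrow> nat \<Rightarrow> real \<Rightarrow> nat \<Rightarrow> int"
  where "int_coord g n x = (SOME c. int_comb g n c = x)"

lemma int_comb_coord: "x \<in> int_span g n \<Longrightarrow> int_comb g n (int_coord g n x) = x"
  unfolding int_coord_def int_span_def by (rule someI_ex[of "\<lambda>c. int_comb g n c = x"]) blast

lemma int_coord_comb:
  assumes "int_indep g n" "i < n"
  shows "int_coord g n (int_comb g n c) i = c i"
  by (rule int_indep_unique[OF assms(1) int_comb_coord assms(2)]) (simp add: int_span_def)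

lemma int_coord_add:
  assumes "int_indep g n" "i < n" "x \<in> int_span g n" "y \<in> int_span g n"
  shows "int_coord g n (x + y) i = int_coord g n x i + int_coord g n y i"
  using int_coord_comb[OF assms(1,2), of "\<lambda>i. int_coord g n x i + int_coord g n y i"]
  by (simp add: int_comb_coord[OF assms(3)] int_comb_coord[OF assms(4)] flip: int_comb_add)

text \<open>Coordinates are additive and a coordinate box contains finitely many points of the span,
  so the lattice theorem applies with coordinates as the additive maps.\<close>

lemma real_subgroup_of_int_span_has_basis:
  assumes g: "int_indep g n" and G: "real_subgroup G" "G \<subseteq> int_span g n"
  shows "\<exists>r\<le>n. \<exists>b. G = int_span b r \<and> int_indep b r"
proof (rule discrete_image_has_basis[OF G(1), of n "\<lambda>j x. real_of_int (int_coord g n x j)"])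
  show "real_of_int (int_coord g n (x + y) j)
      = real_of_int (int_coord g n x j) + real_of_int (int_coord g n y j)"
    if "j < n" "x \<in> G" "y \<in> G" for j x y
    using int_coord_add[OF g that(1), of x y] subsetD[OF G(2)] that by simp
  show "finite {x \<in> G. \<forall>j<n. \<bar>real_of_int (int_coord g n x j)\<bar> \<le> C}" for C
  proof (rule finite_subset)
    show "{x \<in> G. \<forall>j<n. \<bar>real_of_int (int_coord g n x j)\<bar> \<le> C}
        \<subseteq> int_comb g n ` PiE {..<n} (\<lambda>_. {- \<lceil>C\<rceil>..\<lceil>C\<rceil>})"
    proof clarify
      fix x assume x: "x \<in> G" "\<forall>j<n. \<bar>real_of_int (int_coord g n x j)\<bar> \<le> C"
      have "- \<lceil>C\<rceil> \<le> int_coord g n x j" "int_coord g n x j \<le> \<lceil>C\<rceil>" if "j < n" for j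
        using x(2) that by (auto simp: abs_le_iff le_ceiling_iff) (smt (verit) le_of_int_ceiling of_int_le_iff of_int_minus)+
      then have "restrict (int_coord g n x) {..<n} \<in> PiE {..<n} (\<lambda>_. {- \<lceil>C\<rceil>..\<lceil>C\<rceil>})" by auto
      moreover have "int_comb g n (restrict (int_coord g n x) {..<n}) = x"
        using int_comb_coord[of x g n] x(1) G(2) by (auto simp: int_comb_def)
      ultimately show "x \<in> int_comb g n ` PiE {..<n} (\<lambda>_. {- \<lceil>C\<rceil>..\<lceil>C\<rceil>})" by (metis imageI)
    qed
  qed (intro finite_imageI finite_PiE, auto)
qed

section \<open>Multipliers as commuting integer matrices\<close>

definition stabilizer_ring :: "real set \<Rightarrow> real set"
  where "stabilizer_ring \<Gamma> = {x. \<forall>y\<in>\<Gamma>. x * y \<in> \<Gamma>}"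

text \<open>Row \<open>i\<close> holds the coordinates of \<open>x * g i\<close>; with this
  convention the column of generators is an eigenvector with eigenvalue \<open>x\<close>.\<close>

definition multiplication_mat :: "(nat \<Rightarrow> real) \<Rightarrow> nat \<Rightarrow> real \<Rightarrow> int mat"
  where "multiplication_mat g n x = mat n n (\<lambda>(i, j). int_coord g n (x * g i) j)"

lemma real_subgroup_stabilizer_ring: "real_subgroup \<Gamma> \<Longrightarrow> real_subgroup (stabilizer_ring \<Gamma>)"
  unfolding real_subgroup_def stabilizer_ring_def by (auto simp: left_diff_distrib)

lemma stabilizer_ring_mult:
  "x \<in> stabilizer_ring \<Gamma> \<Longrightarrow> y \<in> stabilizer_ring \<Gamma> \<Longrightarrow> x * y \<in> stabilizer_ring \<Gamma>"
  unfolding stabilizer_ring_def by (auto simp: mult.assoc)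

text \<open>A factor \<open>X - a\<close> adds to each lower neighbour the coefficient itself scaled
  by \<open>- a\<close>, so the bound grows by a factor of at most \<open>1 + C\<close>.\<close>

lemma norm_coeff_prod_linear_le:
  fixes xs :: "complex list"
  assumes "\<And>a. a \<in> set xs \<Longrightarrow> norm a \<le> C" "0 \<le> C"
  shows "norm (Polynomial.coeff (\<Prod>a\<leftarrow>xs. [:- a, 1:]) k) \<le> (1 + C) ^ length xs"
  using assms(1)
proof (induction xs arbitrary: k)
  case Nil
  then show ?case by (simp add: coeff_1)
next
  case (Cons a xs)
  define p where "p = (\<Prod>a\<leftarrow>xs. [:- a, 1:])"
  have IH: "norm (Polynomial.coeff p k) \<le> (1 + C) ^ length xs" for k
    unfolding p_def by (rule Cons.IH) (use Cons.prems in auto)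
  have "Polynomial.coeff ([:- a, 1:] * p) k = - a * Polynomial.coeff p k + (case k of 0 \<Rightarrow> 0 | Suc j \<Rightarrow> Polynomial.coeff p j)"
    by (simp add: coeff_pCons)
  also have "norm \<dots> \<le> norm (- a * Polynomial.coeff p k) + norm (case k of 0 \<Rightarrow> 0 | Suc j \<Rightarrow> Polynomial.coeff p j)"
    by (rule norm_triangle_ineq)
  also have "\<dots> \<le> C * (1 + C) ^ length xs + (1 + C) ^ length xs"
  proof (rule add_mono)
    show "norm (- a * Polynomial.coeff p k) \<le> C * (1 + C) ^ length xs"
      unfolding norm_mult norm_minus_cancel using Cons.prems IH assms(2) by (intro mult_mono) auto
    show "norm (case k of 0 \<Rightarrow> 0 | Suc j \<Rightarrow> Polynomial.coeff p j) \<le> (1 + C) ^ length xs"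
      using IH assms(2) by (cases k) auto
  qed
  finally show ?case unfolding p_def by (simp add: algebra_simps)
qed

lemma finite_bounded_int_polys:
  "finite {p :: int Polynomial.poly. Polynomial.degree p \<le> n \<and> (\<forall>k. \<bar>Polynomial.coeff p k\<bar> \<le> B)}"
proof (rule finite_subset)
  show "{p :: int Polynomial.poly. Polynomial.degree p \<le> n \<and> (\<forall>k. \<bar>Polynomial.coeff p k\<bar> \<le> B)}
      \<subseteq> Poly ` {xs. set xs \<subseteq> {- B..B} \<and> length xs = Suc n}"
  proof clarify
    fix p :: "int Polynomial.poly"
    assume p: "Polynomial.degree p \<le> n" "\<forall>k. \<bar>Polynomial.coeff p k\<bar> \<le> B"
    let ?xs = "map (Polynomial.coeff p) [0..<Suc n]"
    have "p = Poly ?xs"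
    proof (rule poly_eqI)
      fix k
      have "Polynomial.coeff (Poly ?xs) k = (if k < Suc n then Polynomial.coeff p k else 0)"
        unfolding coeff_Poly_eq nth_default_def by (auto simp del: upt_Suc)
      then show "Polynomial.coeff p k = Polynomial.coeff (Poly ?xs) k"
        using p(1) coeff_eq_0[of p k] by auto
    qed
    moreover have "set ?xs \<subseteq> {- B..B}" using p(2) by (auto simp: abs_le_iff minus_le_iff)
    ultimately show "p \<in> Poly ` {xs. set xs \<subseteq> {- B..B} \<and> length xs = Suc n}"
      by (intro image_eqI[of _ _ ?xs]) auto
  qed
  show "finite (Poly ` {xs. set xs \<subseteq> {- B..B} \<and> length xs = Suc n})"
    by (intro finite_imageI finite_lists_length_eq) simp
qed

lemma index_mat_mult3:
  assumes "Q \<in> carrier_mat n n" "N \<in> carrier_mat n n" "P \<in> carrier_mat n n" "i < n" "j < n"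
  shows "(Q * N * P) $$ (i, j) = (\<Sum>b<n. \<Sum>a<n. Q $$ (i, a) * N $$ (a, b) * P $$ (b, j))"
  using assms
  by (simp add: scalar_prod_def atLeast0LessThan sum_distrib_left mult.assoc) (rule sum.swap)

context
  fixes g :: "nat \<Rightarrow> real" and n :: nat
  assumes g: "int_indep g n" and one: "1 \<in> int_span g n"
begin

text \<open>Since the span contains 1, \<open>x = x * 1\<close> lies in it. This makes the ring a
  subgroup of a finitely generated group, with a finite basis of its own.\<close>

lemma stabilizer_ring_subset: "stabilizer_ring (int_span g n) \<subseteq> int_span g n"
proof
  fix x assume "x \<in> stabilizer_ring (int_span g n)"
  then have "x * 1 \<in> int_span g n" using one unfolding stabilizer_ring_def by blast
  then show "x \<in> int_span g n" by simp
qed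

lemma stabilizer_ring_gen: "x \<in> stabilizer_ring (int_span g n) \<Longrightarrow> i < n \<Longrightarrow> x * g i \<in> int_span g n"
  unfolding stabilizer_ring_def using int_span_base by blast

lemma multiplication_mat_row:
  assumes "x \<in> stabilizer_ring (int_span g n)" "i < n"
  shows "(\<Sum>j<n. of_int (multiplication_mat g n x $$ (i, j)) * g j) = x * g i"
proof -
  have "(\<Sum>j<n. of_int (multiplication_mat g n x $$ (i, j)) * g j) = int_comb g n (int_coord g n (x * g i))"
    unfolding int_comb_def using assms(2) by (intro sum.cong) (auto simp: multiplication_mat_def)
  then show ?thesis using int_comb_coord[OF stabilizer_ring_gen[OF assms]] by simp
qed

lemma multiplication_mat_carrier: "multiplication_mat g n x \<in> carrier_mat n n"
  by (simp add: multiplication_mat_def)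

text \<open>Independence lets a matrix be recognised by its effect on the generators, so products
  and the identity need no explicit coordinates.\<close>

lemma multiplication_mat_eqI:
  assumes "A \<in> carrier_mat n n"
    and "\<And>i. i < n \<Longrightarrow> (\<Sum>j<n. of_int (A $$ (i, j)) * g j) = x * g i"
  shows "multiplication_mat g n x = A"
proof (rule eq_matI)
  fix i j assume "i < dim_row A" "j < dim_col A"
  then have ij: "i < n" "j < n" using assms(1) by auto
  have "x * g i = int_comb g n (\<lambda>j. A $$ (i, j))" using assms(2)[OF ij(1)] by (simp add: int_comb_def)
  then show "multiplication_mat g n x $$ (i, j) = A $$ (i, j)"
    using int_coord_comb[OF g ij(2)] ij by (simp add: multiplication_mat_def)
qed (use assms(1) in \<open>auto simp: multiplication_mat_def\<close>)

lemma multiplication_mat_mult: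
  assumes x: "x \<in> stabilizer_ring (int_span g n)" and y: "y \<in> stabilizer_ring (int_span g n)"
  shows "multiplication_mat g n (x * y) = multiplication_mat g n x * multiplication_mat g n y"
proof (rule multiplication_mat_eqI)
  let ?X = "multiplication_mat g n x" and ?Y = "multiplication_mat g n y"
  fix i assume i: "i < n"
  have "(\<Sum>k<n. of_int ((?X * ?Y) $$ (i, k)) * g k)
      = (\<Sum>k<n. \<Sum>j<n. of_int (?X $$ (i, j)) * of_int (?Y $$ (j, k)) * g k)"
    using i multiplication_mat_carrier[of x] multiplication_mat_carrier[of y]
    by (intro sum.cong) (auto simp: scalar_prod_def atLeast0LessThan sum_distrib_right)
  also have "\<dots> = (\<Sum>j<n. of_int (?X $$ (i, j)) * (\<Sum>k<n. of_int (?Y $$ (j, k)) * g k))"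
    unfolding sum_distrib_left by (subst sum.swap) (simp add: mult.assoc)
  also have "\<dots> = (\<Sum>j<n. y * (of_int (?X $$ (i, j)) * g j))"
    by (intro sum.cong) (auto simp: multiplication_mat_row[OF y])
  also have "\<dots> = x * y * g i"
    using multiplication_mat_row[OF x i] by (simp flip: sum_distrib_left)
  finally show "(\<Sum>k<n. of_int ((?X * ?Y) $$ (i, k)) * g k) = x * y * g i" .
qed (rule mult_carrier_mat[OF multiplication_mat_carrier multiplication_mat_carrier])

lemma multiplication_mat_one: "multiplication_mat g n 1 = 1\<^sub>m n"
proof (rule multiplication_mat_eqI)
  fix i assume i: "i < n"
  have "(\<Sum>j<n. real_of_int (1\<^sub>m n $$ (i, j)) * g j) = (\<Sum>j<n. if j = i then g j else 0)"
    using i by (intro sum.cong) auto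
  then show "(\<Sum>j<n. of_int (1\<^sub>m n $$ (i, j)) * g j) = 1 * g i" using i by simp
qed simp

text \<open>Additivity of the entries in \<open>x\<close> carries triangularity from finitely many
  generators to the whole ring.\<close>

lemma multiplication_mat_int_comb:
  assumes e: "\<And>l. l < r \<Longrightarrow> e l \<in> stabilizer_ring (int_span g n)" and ij: "i < n" "j < n"
  shows "multiplication_mat g n (int_comb e r c) $$ (i, j) = (\<Sum>l<r. c l * multiplication_mat g n (e l) $$ (i, j))"
proof -
  let ?L = "\<lambda>x. real_of_int (multiplication_mat g n x $$ (i, j))"
  have "?L (int_comb e r c) = (\<Sum>l<r. of_int (c l) * ?L (e l))"
  proof (rule additive_int_comb[OF real_subgroup_stabilizer_ring[OF real_subgroup_int_span] _ e])
    fix x y assume "x \<in> stabilizer_ring (int_span g n)" "y \<in> stabilizer_ring (int_span g n)"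
    then show "?L (x + y) = ?L x + ?L y"
      using int_coord_add[OF g ij(2) stabilizer_ring_gen stabilizer_ring_gen, of x i y i] ij
      by (simp add: multiplication_mat_def distrib_right)
  qed
  then show ?thesis by (simp flip: of_int_mult of_int_sum)
qed

text \<open>The generators form an eigenvector with eigenvalue \<open>x\<close>, nonzero because its
  entries span 1.\<close>

lemma multiplication_mat_root:
  assumes x: "x \<in> stabilizer_ring (int_span g n)"
  shows "poly (map_poly of_int (char_poly (multiplication_mat g n x))) x = 0"
proof -
  let ?X = "map_mat real_of_int (multiplication_mat g n x)"
  have X: "?X \<in> carrier_mat n n" using multiplication_mat_carrier by simp
  have "?X *\<^sub>v Matrix.vec n g = x \<cdot>\<^sub>v Matrix.vec n g"
  proof (rule eq_vecI)
    fix i assume "i < dim_vec (x \<cdot>\<^sub>v Matrix.vec n g)"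
    then have i: "i < n" by simp
    have "(?X *\<^sub>v Matrix.vec n g) $v i = (\<Sum>j<n. of_int (multiplication_mat g n x $$ (i, j)) * g j)"
      using i multiplication_mat_carrier[of x] by (simp add: scalar_prod_def atLeast0LessThan)
    then show "(?X *\<^sub>v Matrix.vec n g) $v i = (x \<cdot>\<^sub>v Matrix.vec n g) $v i"
      using i multiplication_mat_row[OF x i] by simp
  qed (use X in simp)
  moreover have "Matrix.vec n g \<noteq> 0\<^sub>v n"
  proof
    assume 0: "Matrix.vec n g = 0\<^sub>v n"
    have "g i = 0" if "i < n" for i using arg_cong[OF 0, of "\<lambda>w. w $v i"] that by simp
    then have "int_comb g n c = 0" for c by (simp add: int_comb_def)
    with one show False unfolding int_span_def by auto
  qed
  ultimately have "eigenvalue ?X x"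
    unfolding eigenvalue_def eigenvector_def using X by (intro exI[of _ "Matrix.vec n g"]) auto
  then show ?thesis
    unfolding eigenvalue_root_char_poly[OF X] of_int_hom.char_poly_hom[OF multiplication_mat_carrier] .
qed

text \<open>Dirichlet's argument: simultaneous triangularisation of the multiplication matrices supplies
  the \<open>n\<close> complex embeddings (with multiplicity) as diagonal entries. Elements with bounded
  embeddings are roots of finitely many integer polynomials, and the product of the embeddings of
  a unit has modulus 1.\<close>

lemma stabilizer_embeddings:
  obtains d :: "nat \<Rightarrow> real \<Rightarrow> complex" where
    "\<And>i x y. i < n \<Longrightarrow> x \<in> stabilizer_ring (int_span g n) \<Longrightarrow> y \<in> stabilizer_ring (int_span g n)
      \<Longrightarrow> d i (x * y) = d i x * d i y"
    "\<And>i. i < n \<Longrightarrow> d i 1 = 1"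
    "\<And>x. x \<in> stabilizer_ring (int_span g n) \<Longrightarrow>
      map_poly of_int (char_poly (multiplication_mat g n x)) = (\<Prod>a\<leftarrow>map (\<lambda>i. d i x) [0..<n]. [:- a, 1:])"
    "\<And>x. x \<in> stabilizer_ring (int_span g n) \<Longrightarrow>
      of_int (det (multiplication_mat g n x)) = (\<Prod>i<n. d i x)"
proof -
  let ?O = "stabilizer_ring (int_span g n)"
  \<comment> \<open>Simultaneous triangularisation takes a finite family; it is applied to the
    matrices of a finite basis \<open>e\<close> of the ring.\<close>
  obtain r e where e: "?O = int_span e r"
    using real_subgroup_of_int_span_has_basis[OF g real_subgroup_stabilizer_ring[OF real_subgroup_int_span]
        stabilizer_ring_subset] by blast
  have eO: "e l \<in> ?O" if "l < r" for l unfolding e by (rule int_span_base[OF that])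
  define M where "M = (\<lambda>x. map_mat complex_of_int (multiplication_mat g n x))"
  have M: "M x \<in> carrier_mat n n" for x unfolding M_def using multiplication_mat_carrier by simp
  have Mmult: "M (x * y) = M x * M y" if "x \<in> ?O" "y \<in> ?O" for x y
    unfolding M_def multiplication_mat_mult[OF that]
    by (rule of_int_hom.mat_hom_mult[OF multiplication_mat_carrier multiplication_mat_carrier])
  have "M (e k) * M (e l) = M (e l) * M (e k)" if "k \<in> {..<r}" "l \<in> {..<r}" for k l
    using Mmult[of "e k" "e l"] Mmult[of "e l" "e k"] eO that by (simp add: mult.commute)
  then obtain P Q where P: "P \<in> carrier_mat n n" and Q: "Q \<in> carrier_mat n n"
    and PQ: "P * Q = 1\<^sub>m n" and QP: "Q * P = 1\<^sub>m n"
    and ut: "\<And>l. l < r \<Longrightarrow> upper_triangular (Q * M (e l) * P)"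
    using simultaneous_upper_triangular[of "{..<r}" "\<lambda>l. M (e l)" n] M by auto
  define T where "T = (\<lambda>x. Q * M x * P)"
  have T: "T x \<in> carrier_mat n n" for x unfolding T_def using P Q M by auto
  have Tut: "upper_triangular (T x)" if x: "x \<in> ?O" for x
  proof (rule upper_triangularI)
    fix i j assume "j < i" "i < dim_row (T x)"
    then have ij: "j < i" "i < n" "j < n" using T[of x] by auto
    have "x \<in> int_span e r" using x e by simp
    then obtain c where c: "x = int_comb e r c" unfolding int_span_def by auto
    have entry: "M z $$ (a, b) = of_int (multiplication_mat g n z $$ (a, b))" if "a < n" "b < n" for a b z
      unfolding M_def using that multiplication_mat_carrier[of z] by simp
    have "M x $$ (a, b) = (\<Sum>l<r. of_int (c l) * M (e l) $$ (a, b))" if "a < n" "b < n" for a b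
      using multiplication_mat_int_comb[of r e a b c, OF eO] that by (simp add: entry[OF that] c)
    then have "T x $$ (i, j)
        = (\<Sum>b<n. \<Sum>a<n. \<Sum>l<r. of_int (c l) * (Q $$ (i, a) * M (e l) $$ (a, b) * P $$ (b, j)))"
      unfolding T_def index_mat_mult3[OF Q M P ij(2,3)]
      by (intro sum.cong) (auto simp: sum_distrib_left sum_distrib_right mult_ac)
    also have "\<dots> = (\<Sum>l<r. of_int (c l) * T (e l) $$ (i, j))"
      unfolding T_def index_mat_mult3[OF Q M P ij(2,3)] sum_distrib_left
      by (subst sum.swap[of _ _ "{..<r}"], subst sum.swap[of _ _ "{..<r}"]) simp
    also have "\<dots> = 0"
    proof (intro sum.neutral ballI)
      fix l assume "l \<in> {..<r}"
      then have "upper_triangular (T (e l))" using ut unfolding T_def by simp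
      then show "of_int (c l) * T (e l) $$ (i, j) = 0"
        using upper_triangularD[of "T (e l)" j i] ij T[of "e l"] by simp
    qed
    finally show "T x $$ (i, j) = 0" .
  qed
  have Tmult: "T (x * y) = T x * T y" if "x \<in> ?O" "y \<in> ?O" for x y
  proof -
    have "T x * T y = Q * M x * (P * Q) * (M y * P)"
      unfolding T_def using P Q M[of x] M[of y] by (simp add: assoc_mult_mat[of _ n n _ n _ n])
    also have "\<dots> = Q * (M x * M y) * P"
      unfolding PQ using P Q M[of x] M[of y] by (simp add: assoc_mult_mat[of _ n n _ n _ n])
    finally show ?thesis unfolding T_def Mmult[OF that] by simp
  qed
  have sim: "similar_mat (M x) (T x)" for x
  proof -
    have "P * T x * Q = (P * Q) * M x * (P * Q)"
      unfolding T_def using P Q M[of x] by (simp add: assoc_mult_mat[of _ n n _ n _ n])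
    then have "M x = P * T x * Q" unfolding PQ using M[of x] by simp
    then show ?thesis
      unfolding similar_mat_def using similar_mat_witI[OF PQ QP _ M T P Q] by blast
  qed
  have diag: "diag_mat (T x) = map (\<lambda>i. T x $$ (i, i)) [0..<n]" for x
    using T[of x] by (simp add: diag_mat_def)
  show ?thesis
  proof (rule that[of "\<lambda>i x. T x $$ (i, i)"])
    fix i x y assume i: "i < n" and xy: "x \<in> ?O" "y \<in> ?O"
    have "(T x * T y) $$ (i, i) = (\<Sum>k<n. T x $$ (i, k) * T y $$ (k, i))"
      using i T[of x] T[of y] by (simp add: scalar_prod_def atLeast0LessThan)
    also have "\<dots> = T x $$ (i, i) * T y $$ (i, i)"
    proof (subst sum.remove[of _ i])
      \<comment> \<open>For \<open>k < i\<close> the first factor lies strictly below the diagonal,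
        for \<open>k > i\<close> the second.\<close>
      have "T x $$ (i, k) * T y $$ (k, i) = 0" if "k < n" "k \<noteq> i" for k
        using that i upper_triangularD[OF Tut[OF xy(1)], of k i] upper_triangularD[OF Tut[OF xy(2)], of i k]
          T[of x] T[of y] by (cases "k < i") auto
      then show "T x $$ (i, i) * T y $$ (i, i) + (\<Sum>k\<in>{..<n} - {i}. T x $$ (i, k) * T y $$ (k, i))
          = T x $$ (i, i) * T y $$ (i, i)" by (subst sum.neutral) auto
    qed (use i in auto)
    finally show "T (x * y) $$ (i, i) = T x $$ (i, i) * T y $$ (i, i)" unfolding Tmult[OF xy] .
  next
    fix i assume i: "i < n"
    have "M 1 = 1\<^sub>m n" unfolding M_def multiplication_mat_one by (rule of_int_hom.mat_hom_one)
    then have "T 1 = 1\<^sub>m n" unfolding T_def using Q QP by simp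
    then show "T 1 $$ (i, i) = 1" using i by simp
  next
    fix x assume x: "x \<in> ?O"
    show "map_poly of_int (char_poly (multiplication_mat g n x)) = (\<Prod>a\<leftarrow>map (\<lambda>i. T x $$ (i, i)) [0..<n]. [:- a, 1:])"
      using char_poly_similar[OF sim[of x]] char_poly_upper_triangular[OF T Tut[OF x]]
      unfolding diag M_def of_int_hom.char_poly_hom[OF multiplication_mat_carrier] by simp
    have "of_int (det (multiplication_mat g n x)) = det (M x)"
      unfolding M_def by (rule of_int_hom.hom_det[symmetric])
    also have "\<dots> = prod_list (diag_mat (T x))"
      using det_similar[OF sim[of x]] det_upper_triangular[OF Tut[OF x] T] by simp
    also have "\<dots> = (\<Prod>i<n. T x $$ (i, i))"
      unfolding diag by (simp add: prod.list_conv_set_nth atLeast0LessThan)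
    finally show "of_int (det (multiplication_mat g n x)) = (\<Prod>i<n. T x $$ (i, i))" .
  qed
qed

text \<open>The logarithms of the moduli of the \<open>n\<close> characters are additive in
  \<open>t\<close> and sum to zero. The last is determined by the others, so \<open>n - 1\<close> of
  them already have discrete image.\<close>

theorem log_units_have_basis:
  defines "U \<equiv> {t. exp t \<in> stabilizer_ring (int_span g n) \<and> exp (- t) \<in> stabilizer_ring (int_span g n)}"
  shows "\<exists>r\<le>n - 1. \<exists>b. U = int_span b r \<and> int_indep b r"
proof -
  let ?O = "stabilizer_ring (int_span g n)"
  obtain d where mult: "\<And>i x y. i < n \<Longrightarrow> x \<in> ?O \<Longrightarrow> y \<in> ?O \<Longrightarrow> d i (x * y) = d i x * d i y"
    and d1: "\<And>i. i < n \<Longrightarrow> d i 1 = (1 :: complex)"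
    and cp: "\<And>x. x \<in> ?O \<Longrightarrow> map_poly of_int (char_poly (multiplication_mat g n x))
      = (\<Prod>a\<leftarrow>map (\<lambda>i. d i x) [0..<n]. [:- a, 1:])"
    and det: "\<And>x. x \<in> ?O \<Longrightarrow> of_int (det (multiplication_mat g n x)) = (\<Prod>i<n. d i x)"
    using stabilizer_embeddings by blast
  have n0: "n \<noteq> 0"
  proof
    assume "n = 0"
    then show False using one by (auto simp: int_span_def int_comb_def)
  qed
  have one_O: "1 \<in> ?O" by (simp add: stabilizer_ring_def)
  \<comment> \<open>Invertibility of \<open>exp t\<close> keeps every character away from zero, so
    that \<open>ln\<close> of its modulus is additive.\<close>
  have nz: "d i (exp t) \<noteq> 0" if "t \<in> U" "i < n" for t i
  proof -
    have "d i (exp t) * d i (exp (- t)) = d i (exp t * exp (- t))"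
      using mult[OF that(2), of "exp t" "exp (- t)"] that(1) by (simp add: U_def)
    also have "exp t * exp (- t) = 1" by (simp flip: exp_add)
    finally show ?thesis using d1[OF that(2)] by auto
  qed
  have U: "real_subgroup U"
    unfolding real_subgroup_def
  proof (intro conjI ballI)
    show "0 \<in> U" using one_O by (simp add: U_def)
    fix s t assume st: "s \<in> U" "t \<in> U"
    have "exp s * exp (- t) \<in> ?O" "exp (- s) * exp t \<in> ?O"
      using st by (auto simp: U_def intro!: stabilizer_ring_mult)
    then show "s - t \<in> U" by (simp add: U_def flip: exp_add)
  qed
  define L where "L = (\<lambda>i t. ln (norm (d i (exp t))))"
  have add: "L i (s + t) = L i s + L i t" if "i < n" "s \<in> U" "t \<in> U" for i s t
    using mult[OF that(1), of "exp s" "exp t"] nz[OF that(2,1)] nz[OF that(3,1)] that(2,3)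
    by (simp add: L_def exp_add norm_mult ln_mult U_def)
  have sum0: "(\<Sum>i<n. L i t) = 0" if t: "t \<in> U" for t
  proof -
    have O: "exp t \<in> ?O" "exp (- t) \<in> ?O" using t by (auto simp: U_def)
    have "det (multiplication_mat g n (exp t)) * det (multiplication_mat g n (exp (- t)))
        = det (multiplication_mat g n (exp t * exp (- t)))"
      unfolding multiplication_mat_mult[OF O]
      by (rule det_mult[OF multiplication_mat_carrier multiplication_mat_carrier, symmetric])
    also have "\<dots> = 1" by (simp add: multiplication_mat_one flip: exp_add)
    finally have "\<bar>det (multiplication_mat g n (exp t))\<bar> = 1"
      by (metis zmult_eq_1_iff abs_1 abs_minus_cancel)
    then have "norm (\<Prod>i<n. d i (exp t)) = 1"
      unfolding det[OF O(1), symmetric] by (simp add: norm_of_int flip: of_int_abs)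
    then have "ln (\<Prod>i<n. norm (d i (exp t))) = 0" by (simp add: prod_norm)
    then show ?thesis unfolding L_def using nz[OF t] by (subst ln_prod[symmetric]) auto
  qed
  have finO: "finite {x \<in> ?O. \<forall>i<n. norm (d i x) \<le> C}" if C: "0 \<le> C" for C
  proof (rule finite_subset)
    let ?Ps = "{p :: int Polynomial.poly. Polynomial.degree p \<le> n \<and> (\<forall>k. \<bar>Polynomial.coeff p k\<bar> \<le> \<lceil>(1 + C) ^ n\<rceil>)}"
    let ?R = "\<lambda>p. {x. poly (map_poly real_of_int p) x = 0}"
    show "{x \<in> ?O. \<forall>i<n. norm (d i x) \<le> C} \<subseteq> (\<Union>p\<in>?Ps - {0}. ?R p)"
    proof clarify
      fix x assume x: "x \<in> ?O" "\<forall>i<n. norm (d i x) \<le> C"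
      let ?p = "char_poly (multiplication_mat g n x)"
      have deg: "Polynomial.degree ?p = n" "?p \<noteq> 0"
        using degree_monic_char_poly[OF multiplication_mat_carrier, of x] n0 by auto
      have "\<bar>Polynomial.coeff ?p k\<bar> \<le> \<lceil>(1 + C) ^ n\<rceil>" for k
      proof -
        have "norm (Polynomial.coeff (map_poly complex_of_int ?p) k) \<le> (1 + C) ^ n"
          unfolding cp[OF x(1)]
          by (rule order_trans[OF norm_coeff_prod_linear_le]) (use x(2) C in auto)
        then have "\<bar>real_of_int (Polynomial.coeff ?p k)\<bar> \<le> (1 + C) ^ n"
          by (simp add: coeff_map_poly)
        then show ?thesis by linarith
      qed
      with deg multiplication_mat_root[OF x(1)] show "x \<in> (\<Union>p\<in>?Ps - {0}. ?R p)" by auto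
    qed
    have "finite (?R p)" if "p \<noteq> 0" for p
      using that by (intro poly_roots_finite) simp
    then show "finite (\<Union>p\<in>?Ps - {0}. ?R p)"
      using finite_bounded_int_polys[of n] by (intro finite_UN_I) auto
  qed
  show ?thesis
  proof (rule discrete_image_has_basis[OF U, of "n - 1" L])
    show "L j (x + y) = L j x + L j y" if "j < n - 1" "x \<in> U" "y \<in> U" for j x y
      using add that by simp
    show "finite {t \<in> U. \<forall>j<n - 1. \<bar>L j t\<bar> \<le> C}" for C
    proof -
      \<comment> \<open>The last logarithm is minus the sum of the others, so all \<open>n\<close>
        of them are at most \<open>n * \<bar>C\<bar>\<close>; the absolute value covers negative
        \<open>C\<close>.\<close>
      define C' where "C' = exp (real n * \<bar>C\<bar>)"
      have "norm (d i (exp t)) \<le> C'" if t: "t \<in> U" "\<forall>j<n - 1. \<bar>L j t\<bar> \<le> C" and i: "i < n" for t i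
      proof -
        have "L i t \<le> real n * \<bar>C\<bar>"
        proof (cases "i < n - 1")
          case True
          then have "L i t \<le> 1 * \<bar>C\<bar>" using t(2) by fastforce
          also have "\<dots> \<le> real n * \<bar>C\<bar>" using n0 by (intro mult_right_mono) auto
          finally show ?thesis .
        next
          case False
          then have in1: "n = Suc i" using i by auto
          have "L i t = - (\<Sum>j<i. L j t)" using sum0[OF t(1)] unfolding in1 by simp
          also have "\<dots> \<le> (\<Sum>j<i. \<bar>C\<bar>)"
            unfolding sum_negf[symmetric] using t(2) in1 by (intro sum_mono) fastforce
          also have "\<dots> \<le> real n * \<bar>C\<bar>" using in1 by (simp add: mult_right_mono)
          finally show ?thesis .
        qed
        moreover have "norm (d i (exp t)) = exp (L i t)" unfolding L_def using nz[OF t(1) i] by simp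
        ultimately show ?thesis by (simp add: C'_def)
      qed
      then have "exp ` {t \<in> U. \<forall>j<n - 1. \<bar>L j t\<bar> \<le> C} \<subseteq> {x \<in> ?O. \<forall>i<n. norm (d i x) \<le> C'}"
        by (auto simp: U_def)
      then have "finite (exp ` {t \<in> U. \<forall>j<n - 1. \<bar>L j t\<bar> \<le> C})"
        by (rule finite_subset) (rule finO, simp add: C'_def)
      then show ?thesis by (rule finite_imageD) (auto simp: inj_on_def)
    qed
  qed
qed

end

section \<open>Differentiable maps of the quotient line\<close>

lemma coset_eq_iff:
  assumes "real_subgroup \<Gamma>"
  shows "\<Gamma> #>\<^bsub>real_group\<^esub> s = \<Gamma> #>\<^bsub>real_group\<^esub> t \<longleftrightarrow> s - t \<in> \<Gamma>"
proof -
  have c: "\<Gamma> #>\<^bsub>real_group\<^esub> t = {x. x - t \<in> \<Gamma>}" for t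
    by (force simp: r_coset_def real_group_def)
  show ?thesis
  proof
    assume "\<Gamma> #>\<^bsub>real_group\<^esub> s = \<Gamma> #>\<^bsub>real_group\<^esub> t"
    moreover have "s \<in> {x. x - s \<in> \<Gamma>}" using real_subgroup_0[OF assms] by simp
    ultimately show "s - t \<in> \<Gamma>" unfolding c by blast
  next
    assume st: "s - t \<in> \<Gamma>"
    have "x - s \<in> \<Gamma> \<longleftrightarrow> x - t \<in> \<Gamma>" for x
      using real_subgroup_add[OF assms, of "x - s" "s - t"] real_subgroup_diff[OF assms, of "x - t" "s - t"] st
      by auto
    then show "\<Gamma> #>\<^bsub>real_group\<^esub> s = \<Gamma> #>\<^bsub>real_group\<^esub> t" unfolding c by simp
  qed
qed

lemma coset_affine_image:
  assumes "(\<lambda>t. c * t) ` \<Gamma> = \<Gamma>"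
  shows "(\<lambda>x. c * x + b) ` (\<Gamma> #>\<^bsub>real_group\<^esub> t) = \<Gamma> #>\<^bsub>real_group\<^esub> (c * t + b)"
proof -
  have c: "\<Gamma> #>\<^bsub>real_group\<^esub> t = (\<lambda>x. x + t) ` \<Gamma>" for t
    by (auto simp: r_coset_def real_group_def)
  have "(\<lambda>x. c * x + b) ` (\<Gamma> #>\<^bsub>real_group\<^esub> t) = (\<lambda>x. x + (c * t + b)) ` (\<lambda>t. c * t) ` \<Gamma>"
    unfolding c image_image by (simp add: algebra_simps)
  then show ?thesis unfolding assms c .
qed

lemma C_k_const: "C_k k p U (\<lambda>x. c)"
proof (induction k arbitrary: c)
  case (Suc k)
  then show ?case by (auto intro!: exI[of _ "\<lambda>_ _. 0"])
qed simp

lemma C_k_add_const: "C_k k p U f \<Longrightarrow> C_k k p U (\<lambda>x. f x + c)"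
proof (cases k)
  case (Suc j)
  assume "C_k k p U f"
  then obtain h where "continuous_on U f"
    "\<forall>i<p. (\<forall>x\<in>U. ((\<lambda>t. f (x(i := t))) has_vector_derivative h i x) (at (x i))) \<and> C_k j p U (h i)"
    unfolding Suc C_k.simps by blast
  then show ?thesis
    unfolding Suc C_k.simps
    by (intro conjI exI[of _ h]) (auto intro!: continuous_intros simp: has_vector_derivative_add_const)
qed (auto intro: continuous_intros)

lemma standard_diffeology_affine:
  fixes F :: "(nat \<Rightarrow> real) \<Rightarrow> real"
  assumes "standard_diffeology p U F"
  shows "standard_diffeology p U (\<lambda>x. c * F x + b)"
  using standard_diffeology_linear[OF bounded_linear_mult_right[of c] assms]
  by (auto simp: standard_diffeology_def C_infinity_def intro: C_k_add_const)

text \<open>Composed with the projection to cosets, this is the one plot on which a differentiable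
  map is tested.\<close>

lemma standard_diffeology_coordinate:
  "standard_diffeology (Suc 0) (topspace (Euclidean_space (Suc 0))) (\<lambda>x. x 0 :: real)"
proof -
  have cont: "continuous_on U (\<lambda>x. x 0 :: real)" for U :: "(nat \<Rightarrow> real) set"
    by (rule continuous_on_subset[OF continuous_on_product_coordinates]) simp
  have "C_k k (Suc 0) U (\<lambda>x. x 0 :: real)" for k U
  proof (cases k)
    case (Suc j)
    then show ?thesis
      using cont by (auto intro!: exI[of _ "\<lambda>_ _. 1"] C_k_const has_vector_derivative_id[unfolded id_def])
  qed (simp add: cont)
  then show ?thesis by (simp add: standard_diffeology_def C_infinity_def)
qed

text \<open>Along \<open>t \<mapsto> (t, 0, 0, ...)\<close> a smooth lift becomes a function of one
  real variable. \<open>V\<close> is only relatively open among sequences, so the interval comes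
  from pulling back an open set of the product topology.\<close>

lemma standard_diffeology_curve:
  fixes F :: "(nat \<Rightarrow> real) \<Rightarrow> real"
  assumes F: "standard_diffeology (Suc 0) V F" and x: "(\<lambda>i. if i = 0 then x else 0) \<in> V"
  obtains \<epsilon> F' where "\<epsilon> > 0" "\<And>t. t \<in> ball x \<epsilon> \<Longrightarrow> (\<lambda>i. if i = 0 then t else 0) \<in> V"
    "\<And>t. t \<in> ball x \<epsilon> \<Longrightarrow> ((\<lambda>t. F (\<lambda>i. if i = 0 then t else 0)) has_real_derivative F' t) (at t)"
    "continuous_on (ball x \<epsilon>) F'"
proof -
  define e where "e = (\<lambda>t::real. \<lambda>i::nat. if i = 0 then t else 0)"
  have cont: "continuous_on S e" for S
  proof (rule continuous_on_coordinatewise_then_product)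
    fix i show "continuous_on S (\<lambda>t. e t i)" unfolding e_def by (cases "i = 0") auto
  qed
  obtain T where T: "open T" "V = T \<inter> topspace (Euclidean_space (Suc 0))"
    using F unfolding standard_diffeology_def Euclidean_space_def openin_subtopology
    by (auto simp: euclidean_product_topology)
  have "open (e -` T)" using cont[of UNIV] T(1) by (simp add: continuous_on_open_vimage)
  moreover have "x \<in> e -` T" using x T(2) unfolding e_def by auto
  ultimately obtain \<epsilon> where \<epsilon>: "\<epsilon> > 0" "ball x \<epsilon> \<subseteq> e -` T"
    by (meson open_contains_ball)
  have eV: "e t \<in> V" if "t \<in> ball x \<epsilon>" for t
    using that \<epsilon>(2) unfolding T(2) by (auto simp: topspace_Euclidean_space e_def)
  have "C_k (Suc 0) (Suc 0) V F" using F by (simp add: standard_diffeology_def C_infinity_def)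
  then obtain G where G: "\<forall>y\<in>V. ((\<lambda>t. F (y(0 := t))) has_vector_derivative G 0 y) (at (y 0))"
    "continuous_on V (G (0::nat))" by auto
  show ?thesis
  proof (rule that[of \<epsilon> "\<lambda>t. G 0 (e t)"])
    show "(\<lambda>i. if i = 0 then t else 0) \<in> V" if "t \<in> ball x \<epsilon>" for t
      using eV[OF that] unfolding e_def .
    show "((\<lambda>t. F (\<lambda>i. if i = 0 then t else 0)) has_real_derivative G 0 (e t)) (at t)"
      if "t \<in> ball x \<epsilon>" for t
    proof -
      have "(e t)(0 := s) = (\<lambda>i. if i = 0 then s else 0)" for s unfolding e_def by auto
      moreover have "e t 0 = t" unfolding e_def by simp
      ultimately show ?thesis
        using G(1) eV[OF that] by (metis (no_types, lifting) ext has_real_derivative_iff_has_vector_derivative)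
    qed
    show "continuous_on (ball x \<epsilon>) (\<lambda>t. G 0 (e t))"
      using continuous_on_compose2[OF G(2) cont[of "ball x \<epsilon>"]] eV by blast
  qed (rule \<epsilon>(1))
qed

lemma diff_map_comp: "diff_map D E f \<Longrightarrow> diff_map E F h \<Longrightarrow> diff_map D F (h \<circ> f)"
  by (simp add: diff_map_def comp_assoc)

lemma lift_is_affine:
  fixes F F' :: "real \<Rightarrow> real"
  assumes cnt: "countable \<Gamma>" and dense: "\<And>x e. e > 0 \<Longrightarrow> \<exists>\<gamma>\<in>\<Gamma>. \<bar>\<gamma> - x\<bar> < e"
    and der: "\<And>t. t \<in> ball x \<epsilon> \<Longrightarrow> (F has_real_derivative F' t) (at t)"
    and cont: "continuous_on (ball x \<epsilon>) F'"
    and lift: "\<And>s t. s \<in> ball x \<epsilon> \<Longrightarrow> t \<in> ball x \<epsilon> \<Longrightarrow> s - t \<in> \<Gamma> \<Longrightarrow> F s - F t \<in> \<Gamma>"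
  shows "\<exists>c b. \<forall>t\<in>ball x \<epsilon>. F t = c * t + b"
proof (cases "\<epsilon> > 0")
  case True
  then have x: "x \<in> ball x \<epsilon>" by simp
  have shift: "F' (t + \<gamma>) = F' t" if \<gamma>: "\<gamma> \<in> \<Gamma>" "t \<in> ball x \<epsilon>" "t + \<gamma> \<in> ball x \<epsilon>" for t \<gamma>
  proof -
    \<comment> \<open>\<open>W\<close> consists of the points \<open>s\<close> with both
      \<open>s\<close> and \<open>s + \<gamma>\<close> in the ball; an intersection of two balls is
      convex, hence connected.\<close>
    define W where "W = ball x \<epsilon> \<inter> ball (x - \<gamma>) \<epsilon>"
    have W: "s \<in> ball x \<epsilon>" "s + \<gamma> \<in> ball x \<epsilon>" if "s \<in> W" for s
      using that unfolding W_def by (auto simp: dist_real_def)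
    have tW: "t \<in> W" using \<gamma> unfolding W_def by (auto simp: dist_real_def)
    have conn: "connected W" unfolding W_def by (intro convex_connected convex_Int convex_ball)
    define h where "h = (\<lambda>s. F (s + \<gamma>) - F s)"
    have hder: "(h has_real_derivative F' (s + \<gamma>) - F' s) (at s)" if "s \<in> W" for s
      unfolding h_def using der[OF W(1)[OF that]] der[OF W(2)[OF that]]
      by (intro DERIV_diff) (auto simp: DERIV_shift)
    have "continuous_on W h"
      by (intro continuous_at_imp_continuous_on ballI DERIV_isCont[OF hder])
    then have "connected (h ` W)" using conn by (rule connected_continuous_image)
    moreover have "h ` W \<subseteq> \<Gamma>" unfolding h_def using lift[OF W(2) W(1)] \<gamma>(1) by auto
    then have "countable (h ` W)" using cnt by (rule countable_subset)
    \<comment> \<open>A connected set of reals with two distinct points is uncountable.\<close>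
    ultimately have const: "h s = h t" if "s \<in> W" for s
      using connected_uncountable[of "h ` W" "h s" "h t"] that tW by blast
    have "open W" unfolding W_def by auto
    then have "((\<lambda>_. h t) has_real_derivative F' (t + \<gamma>) - F' t) (at t)"
      by (rule has_field_derivative_transform_within_open[OF hder[OF tW] _ tW const])
    then show ?thesis using DERIV_unique[OF _ DERIV_const] by fastforce
  qed
  have const: "F' y = F' x" if y: "y \<in> ball x \<epsilon>" for y
  proof (rule ccontr)
    assume ne: "F' y \<noteq> F' x"
    \<comment> \<open>Near \<open>y\<close>, continuity keeps \<open>F'\<close> away from the value
      \<open>F' x\<close>; by density some \<open>x + \<gamma>\<close> lies there, where
      \<open>F'\<close> takes that value.\<close>
    then obtain d where d: "d > 0" "\<And>z. z \<in> ball x \<epsilon> \<Longrightarrow> dist z y < d \<Longrightarrow> dist (F' z) (F' y) < dist (F' x) (F' y)"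
      using cont y unfolding continuous_on_iff by (metis dist_pos_lt)
    obtain d' where d': "d' > 0" "ball y d' \<subseteq> ball x \<epsilon>" using y by (meson open_ball open_contains_ball)
    obtain \<gamma> where \<gamma>: "\<gamma> \<in> \<Gamma>" "\<bar>\<gamma> - (y - x)\<bar> < min d d'" using dense[of "min d d'" "y - x"] d(1) d'(1) by auto
    have "dist (x + \<gamma>) y < min d d'" using \<gamma>(2) by (simp add: dist_real_def algebra_simps)
    then have "x + \<gamma> \<in> ball x \<epsilon>" "dist (x + \<gamma>) y < d" using d'(2) by (auto simp: dist_commute)
    then show False using d(2) shift[OF \<gamma>(1) x] by fastforce
  qed
  have "((\<lambda>t. F t - F' x * t) has_real_derivative 0) (at t within ball x \<epsilon>)" if "t \<in> ball x \<epsilon>" for t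
  proof -
    have "((\<lambda>t. F t - F' x * t) has_real_derivative F' t - F' x) (at t)"
      by (rule DERIV_diff[OF der[OF that] DERIV_cmult_Id])
    then show ?thesis using const[OF that] by (auto intro: has_field_derivative_at_within)
  qed
  then obtain b where "\<forall>t\<in>ball x \<epsilon>. F t - F' x * t = b"
    using has_field_derivative_zero_constant[OF convex_ball] by blast
  then show ?thesis by (intro exI[of _ "F' x"] exI[of _ b]) (auto simp: algebra_simps)
qed (simp add: not_less ball_empty)

text \<open>A lift near 0 gives the affine formula on an interval of radius \<epsilon>. Density
  globalises it: every coset meets this interval, and the small elements generate \<Gamma>.\<close>

lemma diff_map_real_quot_affine:
  assumes G: "real_subgroup \<Gamma>" and cnt: "countable \<Gamma>"
    and dense: "\<And>x e. e > 0 \<Longrightarrow> \<exists>\<gamma>\<in>\<Gamma>. \<bar>\<gamma> - x\<bar> < e"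
    and f: "diff_map (real_quot_diffeology \<Gamma>) (real_quot_diffeology \<Gamma>) f"
  obtains c b where "\<And>t. f (\<Gamma> #>\<^bsub>real_group\<^esub> t) = \<Gamma> #>\<^bsub>real_group\<^esub> (c * t + b)"
    "\<And>\<gamma>. \<gamma> \<in> \<Gamma> \<Longrightarrow> c * \<gamma> \<in> \<Gamma>"
proof -
  let ?pi = "\<lambda>t. \<Gamma> #>\<^bsub>real_group\<^esub> t"
  let ?U = "topspace (Euclidean_space (Suc 0))"
  define e where "e = (\<lambda>t::real. \<lambda>i::nat. if i = 0 then t else 0)"
  have "real_quot_diffeology \<Gamma> (Suc 0) ?U (\<lambda>x. ?pi (x 0))"
    unfolding real_quot_diffeology_def quotient_diffeology_def
    by (intro conjI ballI exI[of _ ?U] exI[of _ "\<lambda>x. x 0"] standard_diffeology_coordinate) auto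
  then have "real_quot_diffeology \<Gamma> (Suc 0) ?U (f \<circ> (\<lambda>x. ?pi (x 0)))"
    using f unfolding diff_map_def by blast
  then have plot: "\<forall>x\<in>?U. \<exists>V F. x \<in> V \<and> V \<subseteq> ?U \<and> standard_diffeology (Suc 0) V F \<and>
      (\<forall>y\<in>V. f (?pi (y 0)) = ?pi (F y))"
    by (simp add: real_quot_diffeology_def quotient_diffeology_def)
  have "e 0 \<in> ?U" by (simp add: topspace_Euclidean_space e_def)
  from bspec[OF plot this] obtain V F0 where V: "e 0 \<in> V" "standard_diffeology (Suc 0) V F0"
    "\<And>y. y \<in> V \<Longrightarrow> f (?pi (y 0)) = ?pi (F0 y)"
    by blast
  obtain \<epsilon> F' where \<epsilon>: "\<epsilon> > 0" "\<And>t. t \<in> ball 0 \<epsilon> \<Longrightarrow> e t \<in> V"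
    and der: "\<And>t. t \<in> ball 0 \<epsilon> \<Longrightarrow> ((\<lambda>t. F0 (e t)) has_real_derivative F' t) (at t)"
    and cont: "continuous_on (ball 0 \<epsilon>) F'"
    using standard_diffeology_curve[OF V(2), of 0] V(1) unfolding e_def by blast
  define F where "F = (\<lambda>t. F0 (e t))"
  have F: "f (?pi t) = ?pi (F t)" if "t \<in> ball 0 \<epsilon>" for t
    using V(3)[OF \<epsilon>(2)[OF that]] by (simp add: F_def e_def)
  have lift: "F s - F t \<in> \<Gamma>" if "s \<in> ball 0 \<epsilon>" "t \<in> ball 0 \<epsilon>" "s - t \<in> \<Gamma>" for s t
    using F[OF that(1)] F[OF that(2)] that(3) by (metis coset_eq_iff[OF G])
  obtain c b where cb: "\<And>t. t \<in> ball 0 \<epsilon> \<Longrightarrow> F t = c * t + b"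
    using lift_is_affine[OF cnt dense der[folded F_def] cont lift] by blast
  have local: "f (?pi t) = ?pi (c * t + b)" if "\<bar>t\<bar> < \<epsilon>" for t
    using F[of t] cb[of t] that by simp
  have small: "c * \<gamma> \<in> \<Gamma>" if "\<gamma> \<in> \<Gamma>" "\<bar>\<gamma>\<bar> < \<epsilon>" for \<gamma>
    using lift[of \<gamma> 0] cb[of \<gamma>] cb[of 0] that \<epsilon>(1) by simp
  have c: "c * \<gamma> \<in> \<Gamma>" if \<gamma>: "\<gamma> \<in> \<Gamma>" for \<gamma>
  proof -
    \<comment> \<open>So far \<open>c * \<gamma> \<in> \<Gamma>\<close> is known for small
      \<open>\<gamma>\<close>. Division with remainder by a small positive
      \<open>\<delta> \<in> \<Gamma>\<close> reduces the general case to \<open>\<delta>\<close> and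
      the remainder.\<close>
    obtain \<delta> where \<delta>: "\<delta> \<in> \<Gamma>" "\<bar>\<delta> - \<epsilon> / 2\<bar> < \<epsilon> / 2" using dense[of "\<epsilon> / 2" "\<epsilon> / 2"] \<epsilon>(1) by auto
    then have \<delta>': "0 < \<delta>" "\<delta> < \<epsilon>" by linarith+
    define k where "k = \<lfloor>\<gamma> / \<delta>\<rfloor>"
    define \<rho> where "\<rho> = \<gamma> - of_int k * \<delta>"
    have "of_int k \<le> \<gamma> / \<delta>" "\<gamma> / \<delta> < of_int k + 1" unfolding k_def by linarith+
    then have "0 \<le> \<rho>" "\<rho> < \<delta>" using \<delta>' unfolding \<rho>_def by (simp_all add: field_simps)
    moreover have "\<rho> \<in> \<Gamma>"
      unfolding \<rho>_def by (intro real_subgroup_diff real_subgroup_of_int_mult G \<gamma> \<delta>)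
    ultimately have "c * \<rho> \<in> \<Gamma>" "c * \<delta> \<in> \<Gamma>" using small \<delta> \<delta>' by auto
    then have "c * \<rho> + of_int k * (c * \<delta>) \<in> \<Gamma>"
      by (intro real_subgroup_add real_subgroup_of_int_mult G)
    then show ?thesis unfolding \<rho>_def by (simp add: algebra_simps)
  qed
  have "f (?pi t) = ?pi (c * t + b)" for t
  proof -
    obtain \<gamma> where \<gamma>: "\<gamma> \<in> \<Gamma>" "\<bar>\<gamma> - t\<bar> < \<epsilon>" using dense \<epsilon>(1) by blast
    have "?pi t = ?pi (t - \<gamma>)" using \<gamma>(1) by (simp add: coset_eq_iff[OF G])
    moreover have "?pi (c * t + b) = ?pi (c * (t - \<gamma>) + b)"
      using c[OF \<gamma>(1)] by (simp add: coset_eq_iff[OF G] algebra_simps)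
    ultimately show ?thesis using local[of "t - \<gamma>"] \<gamma>(2) by (simp add: abs_minus_commute)
  qed
  with c show ?thesis by (rule that[rotated])
qed

lemma affine_diff_map_real_quot:
  assumes "\<And>t. f (\<Gamma> #>\<^bsub>real_group\<^esub> t) = \<Gamma> #>\<^bsub>real_group\<^esub> (c * t + b)"
  shows "diff_map (real_quot_diffeology \<Gamma>) (real_quot_diffeology \<Gamma>) f"
  unfolding diff_map_def
proof (intro allI impI)
  fix p U u assume u: "real_quot_diffeology \<Gamma> p U u"
  show "real_quot_diffeology \<Gamma> p U (f \<circ> u)"
    unfolding real_quot_diffeology_def quotient_diffeology_def
  proof (intro conjI ballI)
    show "openin (Euclidean_space p) U"
      using u by (simp add: real_quot_diffeology_def quotient_diffeology_def)
    fix x assume "x \<in> U"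
    then obtain V F where "x \<in> V" "V \<subseteq> U" "standard_diffeology p V F"
      "\<forall>y\<in>V. u y = \<Gamma> #>\<^bsub>real_group\<^esub> F y"
      using u unfolding real_quot_diffeology_def quotient_diffeology_def by blast
    then show "\<exists>V F. x \<in> V \<and> V \<subseteq> U \<and> standard_diffeology p V F \<and>
        (\<forall>y\<in>V. (f \<circ> u) y = \<Gamma> #>\<^bsub>real_group\<^esub> F y)"
      using standard_diffeology_affine[of p V F c b] assms
      by (intro exI[of _ V] exI[of _ "\<lambda>y. c * F y + b"]) auto
  qed
qed

text \<open>A nonconstant affine map is onto the reals. Applied to differences of lifts, this makes
  slopes unique and the slopes of inverse maps reciprocal.\<close>

lemma affine_into_countable:
  fixes c b :: real
  assumes "countable \<Gamma>" "\<And>t. c * t + b \<in> \<Gamma>"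
  shows "c = 0"
proof (rule ccontr)
  assume c: "c \<noteq> 0"
  have "x \<in> \<Gamma>" for x using assms(2)[of "(x - b) / c"] c by simp
  then have "\<Gamma> = UNIV" by blast
  with assms(1) show False by (simp add: uncountable_UNIV_real)
qed

section \<open>Leaf spaces\<close>

text \<open>Total coefficient sequences are uncountably many; cutting them off at \<open>n\<close>
  leaves countably many and the same combinations.\<close>

lemma countable_int_span: "countable (int_span b n)"
proof -
  have "int_span b n \<subseteq> int_comb b n ` PiE {..<n} (\<lambda>_. UNIV)"
    unfolding int_span_def
  proof clarify
    fix c
    have "int_comb b n c = int_comb b n (restrict c {..<n})" by (simp add: int_comb_def)
    moreover have "restrict c {..<n} \<in> PiE {..<n} (\<lambda>_. UNIV)" by simp
    ultimately show "int_comb b n c \<in> int_comb b n ` PiE {..<n} (\<lambda>_. UNIV)" by (metis imageI)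
  qed
  then show ?thesis by (rule countable_subset) (intro countable_image countable_PiE, auto)
qed

lemma real_subgroup_holonomy: "real_subgroup (holonomy \<xi>)"
  unfolding real_subgroup_def using holonomy_zero holonomy_add[OF _ holonomy_minus] by force

lemma holonomy_has_basis:
  fixes \<xi> :: "real^'m"
  obtains n g where "n \<le> Suc CARD('m)" "holonomy \<xi> = int_span g n" "int_indep g n" "1 \<in> int_span g n"
proof -
  obtain f where f: "bij_betw f {..<CARD('m)} (UNIV :: 'm set)"
    using ex_bij_betw_nat_finite[of "UNIV :: 'm set"] by (auto simp: atLeast0LessThan)
  \<comment> \<open>The generator 1 takes the slot after the components of \<xi>. These
    \<open>m + 1\<close> generators are the source of the bound \<open>r \<le> m\<close>.\<close>
  define g where "g = (\<lambda>i. if i < CARD('m) then \<xi> $ f i else 1)"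
  have gen: "1 \<in> holonomy \<xi>" "\<xi> $ i \<in> holonomy \<xi>" for i
    unfolding holonomy_def by (auto intro: generate.incl)
  have 1: "1 \<in> int_span g (Suc CARD('m))"
    using int_span_base[of "CARD('m)" "Suc CARD('m)" g] by (simp add: g_def)
  have \<xi>: "\<xi> $ j \<in> int_span g (Suc CARD('m))" for j
  proof -
    obtain i where "i < CARD('m)" "f i = j" using f unfolding bij_betw_def by (metis UNIV_I imageE lessThan_iff)
    then show ?thesis using int_span_base[of i "Suc CARD('m)" g] by (simp add: g_def)
  qed
  have "h \<in> int_span g (Suc CARD('m))" if "h \<in> holonomy \<xi>" for h
    using that unfolding holonomy_def
  proof (induction rule: generate.induct)
    case one
    then show ?case using real_subgroup_0[OF real_subgroup_int_span] by (simp add: real_group_def)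
  next
    case (incl h)
    then show ?case using 1 \<xi> by auto
  next
    case (inv h)
    then show ?case using 1 \<xi> by (auto simp: inv_real_group intro!: real_subgroup_minus real_subgroup_int_span)
  next
    case (eng h1 h2)
    then show ?case
      using real_subgroup_add[OF real_subgroup_int_span] by (simp add: real_group_def)
  qed
  moreover have "int_span g (Suc CARD('m)) \<subseteq> holonomy \<xi>"
    using gen by (intro int_span_subset real_subgroup_holonomy) (auto simp: g_def)
  ultimately have "holonomy \<xi> = int_span g (Suc CARD('m))" by blast
  moreover obtain n b where "n \<le> Suc CARD('m)" "int_span b n = int_span g (Suc CARD('m))" "int_indep b n"
    using int_span_has_basis by blast
  ultimately show ?thesis using that gen(1) by metis
qed

text \<open>By Kronecker's theorem the numbers \<open>k * \<xi> $ i - h\<close> with integers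
  \<open>h\<close> and \<open>k\<close> are already dense.\<close>

lemma holonomy_dense:
  assumes "\<xi> $ i \<notin> \<rat>" "e > 0"
  shows "\<exists>\<gamma>\<in>holonomy \<xi>. \<bar>\<gamma> - x\<bar> < e"
proof -
  obtain h k where hk: "\<bar>of_int k * \<xi> $ i - of_int h - x\<bar> < e"
    using sequence_of_fractional_parts_is_dense[OF assms] by metis
  have "1 \<in> holonomy \<xi>" "\<xi> $ i \<in> holonomy \<xi>"
    unfolding holonomy_def by (auto intro: generate.incl)
  then have "of_int k * \<xi> $ i - of_int h * 1 \<in> holonomy \<xi>"
    by (intro real_subgroup_diff real_subgroup_of_int_mult real_subgroup_holonomy)
  with hk show ?thesis by (intro bexI) auto
qed

section \<open>Linear automorphisms of the holonomy group\<close>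

lemma mult_image_eq_iff:
  assumes "c \<noteq> 0"
  shows "(\<lambda>t. c * t) ` \<Gamma> = \<Gamma> \<longleftrightarrow> c \<in> stabilizer_ring \<Gamma> \<and> inverse c \<in> stabilizer_ring \<Gamma>"
proof
  assume eq: "(\<lambda>t. c * t) ` \<Gamma> = \<Gamma>"
  have "inverse c * y \<in> \<Gamma>" if "y \<in> \<Gamma>" for y
  proof -
    from that eq obtain z where "z \<in> \<Gamma>" "y = c * z" by blast
    then show ?thesis using assms by (simp flip: mult.assoc)
  qed
  with eq show "c \<in> stabilizer_ring \<Gamma> \<and> inverse c \<in> stabilizer_ring \<Gamma>"
    unfolding stabilizer_ring_def by blast
next
  assume c: "c \<in> stabilizer_ring \<Gamma> \<and> inverse c \<in> stabilizer_ring \<Gamma>"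
  have "y \<in> (\<lambda>t. c * t) ` \<Gamma>" if "y \<in> \<Gamma>" for y
    using c that assms unfolding stabilizer_ring_def by (intro image_eqI[of _ _ "inverse c * y"]) auto
  with c show "(\<lambda>t. c * t) ` \<Gamma> = \<Gamma>" unfolding stabilizer_ring_def by blast
qed

lemma linear_in_Bij: "c \<noteq> 0 \<Longrightarrow> (\<lambda>t::real. c * t) \<in> Bij UNIV"
  by (auto simp: Bij_def intro!: bij_betw_byWitness[of _ "\<lambda>t. t / c"])

lemma carrier_Z2_times_Z_power: "carrier (Z2_times_Z_power r) = {0..<2} \<times> PiE {..<r} (\<lambda>_. UNIV)"
  by (simp add: Z2_times_Z_power_def DirProd_def integer_mod_group_def product_group_def integer_group_def)

lemma mult_Z2_times_Z_power:
  "(e, k) \<otimes>\<^bsub>Z2_times_Z_power r\<^esub> (e', k') = ((e + e') mod 2, \<lambda>i\<in>{..<r}. k i + k' i)"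
  by (simp add: Z2_times_Z_power_def DirProd_def integer_mod_group_def product_group_def integer_group_def)

text \<open>A multiplier is its sign times \<open>exp (ln \<bar>c\<bar>)\<close>. Both signs occur
  because \<Gamma> is closed under negation, and \<open>ln \<bar>c\<bar>\<close> runs through the
  free group of logarithmic units.\<close>

lemma Aut_lin_iso:
  assumes g: "int_indep g n" "1 \<in> int_span g n"
  obtains r \<phi> where "r \<le> n - 1" "\<phi> \<in> iso (Z2_times_Z_power r) (Aut_lin (int_span g n))"
proof -
  let ?\<Gamma> = "int_span g n"
  let ?O = "stabilizer_ring ?\<Gamma>"
  obtain r b where r: "r \<le> n - 1" "int_indep b r"
    and b: "{t. exp t \<in> ?O \<and> exp (- t) \<in> ?O} = int_span b r"
    using log_units_have_basis[OF g] by blast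
  have neg: "- c \<in> ?O \<longleftrightarrow> c \<in> ?O" for c
    using real_subgroup_minus[OF real_subgroup_stabilizer_ring[OF real_subgroup_int_span], of c g n]
      real_subgroup_minus[OF real_subgroup_stabilizer_ring[OF real_subgroup_int_span], of "- c" g n] by auto
  have abs: "\<bar>c\<bar> \<in> ?O \<longleftrightarrow> c \<in> ?O" for c using neg[of c] by (simp add: abs_if)
  have unit: "(\<lambda>t. c * t) ` ?\<Gamma> = ?\<Gamma> \<longleftrightarrow> ln \<bar>c\<bar> \<in> int_span b r" if "c \<noteq> 0" for c
    unfolding mult_image_eq_iff[OF that] b[symmetric]
    using that abs[of c] abs[of "inverse c"] by (simp add: exp_minus)
  define s where "s = (\<lambda>e::int. if e = 0 then 1 else - 1 :: real)"
  define coeff where "coeff = (\<lambda>(e, k). s e * exp (int_comb b r k))"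
  define \<phi> where "\<phi> = (\<lambda>a t. coeff a * t)"
  let ?Z = "Z2_times_Z_power r"
  note car = carrier_Z2_times_Z_power
  have nz: "coeff a \<noteq> 0" for a by (simp add: coeff_def s_def split: prod.split)
  have ln_coeff: "ln \<bar>coeff (e, k)\<bar> = int_comb b r k" for e k by (simp add: coeff_def s_def abs_mult)
  have mult: "coeff (a \<otimes>\<^bsub>?Z\<^esub> a') = coeff a * coeff a'"
    if a: "a \<in> carrier ?Z" "a' \<in> carrier ?Z" for a a'
  proof -
    obtain e k e' k' where ek: "a = (e, k)" "a' = (e', k')" "e \<in> {0..<2}" "e' \<in> {0..<2}"
      using a unfolding car by auto
    have prod: "a \<otimes>\<^bsub>?Z\<^esub> a' = ((e + e') mod 2, \<lambda>i\<in>{..<r}. k i + k' i)"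
      by (simp add: ek mult_Z2_times_Z_power)
    have "e = 0 \<or> e = 1" "e' = 0 \<or> e' = 1" using ek by auto
    then have "s ((e + e') mod 2) = s e * s e'" by (auto simp: s_def)
    moreover have "int_comb b r (\<lambda>i\<in>{..<r}. k i + k' i) = int_comb b r k + int_comb b r k'"
      unfolding int_comb_add by (simp add: int_comb_def)
    ultimately show ?thesis unfolding prod by (simp add: ek coeff_def exp_add)
  qed
  have "\<phi> \<in> iso ?Z (Aut_lin ?\<Gamma>)"
    unfolding iso_def hom_def
  proof (intro CollectI conjI ballI)
    show \<phi>car: "\<phi> \<in> carrier ?Z \<rightarrow> carrier (Aut_lin ?\<Gamma>)"
    proof
      fix a assume "a \<in> carrier ?Z"
      then obtain e k where "a = (e, k)" by (cases a)
      then have "(\<lambda>t. coeff a * t) ` ?\<Gamma> = ?\<Gamma>"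
        unfolding unit[OF nz] by (simp add: ln_coeff int_span_def)
      then show "\<phi> a \<in> carrier (Aut_lin ?\<Gamma>)"
        unfolding Aut_lin_def \<phi>_def using nz[of a] by auto
    qed
    show "\<phi> (a \<otimes>\<^bsub>?Z\<^esub> a') = \<phi> a \<otimes>\<^bsub>Aut_lin ?\<Gamma>\<^esub> \<phi> a'"
      if "a \<in> carrier ?Z" "a' \<in> carrier ?Z" for a a'
      using linear_in_Bij[OF nz]
      by (simp add: \<phi>_def mult[OF that] Aut_lin_def BijGroup_def compose_def restrict_def fun_eq_iff mult.assoc)
    show "bij_betw \<phi> (carrier ?Z) (carrier (Aut_lin ?\<Gamma>))"
      unfolding bij_betw_def
    proof
      show "inj_on \<phi> (carrier ?Z)"
      proof (rule inj_onI)
        fix a a' assume a: "a \<in> carrier ?Z" "a' \<in> carrier ?Z" "\<phi> a = \<phi> a'"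
        obtain e k e' k' where ek: "a = (e, k)" "a' = (e', k')" "e \<in> {0..<2}" "e' \<in> {0..<2}"
          "k \<in> PiE {..<r} (\<lambda>_. UNIV)" "k' \<in> PiE {..<r} (\<lambda>_. UNIV)"
          using a(1,2) unfolding car by auto
        have c: "coeff a = coeff a'" using fun_cong[OF a(3), of 1] by (simp add: \<phi>_def)
        then have kk: "int_comb b r k = int_comb b r k'" using ln_coeff ek(1,2) by metis
        have "k = k'" using int_indep_unique[OF r(2) kk] ek(5,6) by (intro PiE_ext) auto
        moreover have "s e = s e'" using c kk by (simp add: ek coeff_def)
        then have "e = e'" using ek(3,4) by (auto simp: s_def split: if_splits)
        ultimately show "a = a'" using ek by simp
      qed
      have "f \<in> \<phi> ` carrier ?Z" if f: "f \<in> carrier (Aut_lin ?\<Gamma>)" for f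
      proof -
        obtain c where c: "c \<noteq> 0" "f = (\<lambda>t. c * t)" "(\<lambda>t. c * t) ` ?\<Gamma> = ?\<Gamma>"
          using f by (auto simp: Aut_lin_def)
        then have "ln \<bar>c\<bar> \<in> int_span b r" using unit by blast
        then obtain k where k: "ln \<bar>c\<bar> = int_comb b r k" unfolding int_span_def by auto
        define e where "e = (if c > 0 then 0 else 1 :: int)"
        \<comment> \<open>The carrier contains extensional functions only, so the coefficients are
          cut off at \<open>r\<close>.\<close>
        have "int_comb b r (restrict k {..<r}) = ln \<bar>c\<bar>" unfolding k by (simp add: int_comb_def)
        then have "coeff (e, restrict k {..<r}) = c"
          using c(1) by (auto simp: coeff_def e_def s_def)
        moreover have "(e, restrict k {..<r}) \<in> carrier ?Z" unfolding car e_def by auto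
        ultimately show ?thesis by (intro image_eqI[of _ _ "(e, restrict k {..<r})"]) (auto simp: \<phi>_def c(2))
      qed
      then show "\<phi> ` carrier ?Z = carrier (Aut_lin ?\<Gamma>)" using \<phi>car by auto
    qed
  qed
  with r(1) show ?thesis by (rule that)
qed

text \<open>The line \<open>x = 0\<close> is a transversal that meets every leaf in one coset of
  \<Gamma>; it provides a real coordinate for maps of the leaf space.\<close>

definition leaf_at :: "real^'m \<Rightarrow> real \<Rightarrow> ((real^'m) \<times> real) set set"
  where "leaf_at \<xi> t = leaf \<xi> (torus_proj (0, t))"

lemma leaf_at_mem: "leaf_at \<xi> t \<in> leaf_space \<xi>"
  by (simp add: leaf_at_def leaf_space_def)

lemma leaf_to_coset_leaf_at: "leaf_to_coset \<xi> (leaf_at \<xi> t) = holonomy \<xi> #>\<^bsub>real_group\<^esub> t"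
  by (simp add: leaf_at_def leaf_to_coset_leaf) (simp add: omega_def)

lemma inv_leaf_to_coset: "inv_into (leaf_space \<xi>) (leaf_to_coset \<xi>) (holonomy \<xi> #>\<^bsub>real_group\<^esub> t) = leaf_at \<xi> t"
  using bij_betw_inv_into_left[OF bij_betw_leaf_to_coset leaf_at_mem, of \<xi> t]
  by (simp add: leaf_to_coset_leaf_at)

lemma leaf_at_eq_iff: "leaf_at \<xi> s = leaf_at \<xi> t \<longleftrightarrow> s - t \<in> holonomy \<xi>"
  unfolding coset_eq_iff[OF real_subgroup_holonomy, symmetric] leaf_to_coset_leaf_at[symmetric]
  by (rule inj_on_eq_iff[OF bij_betw_imp_inj_on[OF bij_betw_leaf_to_coset] leaf_at_mem leaf_at_mem, symmetric])

lemma leaf_space_eq: "leaf_space \<xi> = range (leaf_at \<xi>)"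
proof -
  have "leaf \<xi> (torus_proj p) = leaf_at \<xi> (omega \<xi> p)" for p
  proof -
    have "leaf \<xi> (torus_proj p) \<in> leaf_space \<xi>" by (simp add: leaf_space_def)
    from bij_betw_inv_into_left[OF bij_betw_leaf_to_coset this] show ?thesis
      unfolding leaf_to_coset_leaf inv_leaf_to_coset by simp
  qed
  then have "leaf_space \<xi> \<subseteq> range (leaf_at \<xi>)" unfolding leaf_space_def by blast
  moreover have "range (leaf_at \<xi>) \<subseteq> leaf_space \<xi>" using leaf_at_mem by blast
  ultimately show ?thesis by (rule equalityI)
qed

lemma leaf_diffeology_plot_mem: "leaf_diffeology \<xi> p U u \<Longrightarrow> x \<in> U \<Longrightarrow> u x \<in> leaf_space \<xi>"
  unfolding leaf_diffeology_def torus_diffeology_def quotient_diffeology_def leaf_space_def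
  by (metis imageI rangeI)

lemma quotient_diffeology_cong:
  "quotient_diffeology \<pi> D p U u \<Longrightarrow> (\<And>x. x \<in> U \<Longrightarrow> u x = v x) \<Longrightarrow> quotient_diffeology \<pi> D p U v"
  unfolding quotient_diffeology_def by (metis subsetD)

text \<open>The map is transported to cosets and back. The round trip agrees with \<open>h\<close>
  only on \<open>leaf_space \<xi>\<close>, which is enough because plots take their values
  there.\<close>

lemma affine_diff_map_leaf:
  assumes h: "\<And>t. h (leaf_at \<xi> t) = leaf_at \<xi> (c * t + b)"
  shows "diff_map (leaf_diffeology \<xi>) (leaf_diffeology \<xi>) h"
proof -
  let ?\<Phi> = "leaf_to_coset \<xi>" and ?\<Psi> = "inv_into (leaf_space \<xi>) (leaf_to_coset \<xi>)"
  define f where "f = ?\<Phi> \<circ> h \<circ> ?\<Psi>"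
  have "diff_map (real_quot_diffeology (holonomy \<xi>)) (real_quot_diffeology (holonomy \<xi>)) f"
    by (rule affine_diff_map_real_quot[of _ _ c b]) (simp add: f_def inv_leaf_to_coset h leaf_to_coset_leaf_at)
  then have dm: "diff_map (leaf_diffeology \<xi>) (leaf_diffeology \<xi>) (?\<Psi> \<circ> (f \<circ> ?\<Phi>))"
    using diff_iso_leaf_to_coset[of \<xi>] unfolding diff_iso_def by (blast intro: diff_map_comp)
  have eq: "(?\<Psi> \<circ> (f \<circ> ?\<Phi>)) L = h L" if L: "L \<in> leaf_space \<xi>" for L
  proof -
    obtain t where "L = leaf_at \<xi> t" using L unfolding leaf_space_eq by blast
    then show ?thesis by (simp add: f_def leaf_to_coset_leaf_at inv_leaf_to_coset h)
  qed
  show ?thesis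
    unfolding diff_map_def
  proof (intro allI impI)
    fix p U u assume u: "leaf_diffeology \<xi> p U u"
    then have "leaf_diffeology \<xi> p U ((?\<Psi> \<circ> (f \<circ> ?\<Phi>)) \<circ> u)" using dm unfolding diff_map_def by blast
    then show "leaf_diffeology \<xi> p U (h \<circ> u)"
      unfolding leaf_diffeology_def
      by (rule quotient_diffeology_cong) (use eq leaf_diffeology_plot_mem[OF u] in simp)
  qed
qed

lemma affine_in_Diff:
  assumes c: "c \<noteq> 0" "(\<lambda>t. c * t) ` holonomy \<xi> = holonomy \<xi>"
    and h: "h \<in> extensional (leaf_space \<xi>)" "\<And>t. h (leaf_at \<xi> t) = leaf_at \<xi> (c * t + b)"
  shows "h \<in> carrier (Diff (leaf_space \<xi>) (leaf_diffeology \<xi>))"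
proof -
  have stab: "c * x \<in> holonomy \<xi> \<longleftrightarrow> x \<in> holonomy \<xi>" for x
    using c by (metis (no_types, lifting) image_iff mult_left_cancel)
  have inj: "inj_on h (leaf_space \<xi>)"
  proof (rule inj_onI)
    fix L L' assume "L \<in> leaf_space \<xi>" "L' \<in> leaf_space \<xi>" "h L = h L'"
    then obtain t t' where t: "L = leaf_at \<xi> t" "L' = leaf_at \<xi> t'"
      "leaf_at \<xi> (c * t + b) = leaf_at \<xi> (c * t' + b)" unfolding leaf_space_eq by (auto simp: h(2))
    then have "c * (t - t') \<in> holonomy \<xi>" by (simp add: leaf_at_eq_iff algebra_simps)
    then show "L = L'" unfolding stab t by (simp add: leaf_at_eq_iff)
  qed
  \<comment> \<open>The inverse of \<open>t \<mapsto> c * t + b\<close> is affine again, so its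
    differentiability follows from the same lemma as that of \<open>h\<close>.\<close>
  have h': "h (leaf_at \<xi> (inverse c * t + - b / c)) = leaf_at \<xi> t" for t
    using c(1) by (simp add: h(2) field_simps)
  have "h ` leaf_space \<xi> = leaf_space \<xi>"
  proof
    show "h ` leaf_space \<xi> \<subseteq> leaf_space \<xi>" unfolding leaf_space_eq by (auto simp: h(2))
    show "leaf_space \<xi> \<subseteq> h ` leaf_space \<xi>"
      using h' leaf_at_mem[of \<xi>] unfolding leaf_space_eq by (metis (no_types, lifting) image_eqI image_subsetI rangeI)
  qed
  with inj have bij: "bij_betw h (leaf_space \<xi>) (leaf_space \<xi>)" by (simp add: bij_betw_def)
  have "inv_into (leaf_space \<xi>) h (leaf_at \<xi> t) = leaf_at \<xi> (inverse c * t + - b / c)" for t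
    by (rule inv_into_f_eq[OF inj leaf_at_mem h'])
  then have "diff_iso (leaf_space \<xi>) (leaf_diffeology \<xi>) (leaf_space \<xi>) (leaf_diffeology \<xi>) h"
    unfolding diff_iso_def using bij affine_diff_map_leaf h(2) by blast
  then show ?thesis using bij h(1) by (simp add: Diff_def Bij_def)
qed

text \<open>Both \<open>h\<close> and its inverse have affine lifts whose slopes map \<Gamma> into
  itself. The slopes are reciprocal, so \<open>c\<close> is a unit of the multiplier ring.\<close>

lemma Diff_is_affine:
  assumes \<xi>: "\<xi> $ i \<notin> \<rat>"
    and h: "h \<in> carrier (Diff (leaf_space \<xi>) (leaf_diffeology \<xi>))"
  obtains c b where "c \<noteq> 0" "(\<lambda>t. c * t) ` holonomy \<xi> = holonomy \<xi>"
    "\<And>t. h (leaf_at \<xi> t) = leaf_at \<xi> (c * t + b)"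
proof -
  let ?\<Gamma> = "holonomy \<xi>"
  let ?\<Phi> = "leaf_to_coset \<xi>" and ?\<Psi> = "inv_into (leaf_space \<xi>) (leaf_to_coset \<xi>)"
  have cnt: "countable ?\<Gamma>" by (metis holonomy_has_basis countable_int_span)
  have bij: "bij_betw h (leaf_space \<xi>) (leaf_space \<xi>)"
    and dm: "diff_map (leaf_diffeology \<xi>) (leaf_diffeology \<xi>) h"
      "diff_map (leaf_diffeology \<xi>) (leaf_diffeology \<xi>) (inv_into (leaf_space \<xi>) h)"
    using h by (auto simp: Diff_def diff_iso_def)
  have affine: "\<exists>c b. (\<forall>t. k (leaf_at \<xi> t) = leaf_at \<xi> (c * t + b)) \<and> c \<in> stabilizer_ring ?\<Gamma>"
    if k: "diff_map (leaf_diffeology \<xi>) (leaf_diffeology \<xi>) k" "k ` leaf_space \<xi> \<subseteq> leaf_space \<xi>" for k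
  proof -
    have "diff_map (real_quot_diffeology ?\<Gamma>) (real_quot_diffeology ?\<Gamma>) (?\<Phi> \<circ> (k \<circ> ?\<Psi>))"
      using diff_iso_leaf_to_coset[of \<xi>] k(1) unfolding diff_iso_def by (blast intro: diff_map_comp)
    then obtain c b where cb: "\<And>t. (?\<Phi> \<circ> (k \<circ> ?\<Psi>)) (?\<Gamma> #>\<^bsub>real_group\<^esub> t) = ?\<Gamma> #>\<^bsub>real_group\<^esub> (c * t + b)"
      "\<And>\<gamma>. \<gamma> \<in> ?\<Gamma> \<Longrightarrow> c * \<gamma> \<in> ?\<Gamma>"
      using diff_map_real_quot_affine[OF real_subgroup_holonomy cnt holonomy_dense[OF \<xi>]] by blast
    have "k (leaf_at \<xi> t) = leaf_at \<xi> (c * t + b)" for t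
    proof -
      have "k (leaf_at \<xi> t) \<in> leaf_space \<xi>" using k(2) leaf_at_mem by blast
      then obtain t' where t': "k (leaf_at \<xi> t) = leaf_at \<xi> t'" unfolding leaf_space_eq by blast
      then have "?\<Gamma> #>\<^bsub>real_group\<^esub> t' = ?\<Gamma> #>\<^bsub>real_group\<^esub> (c * t + b)"
        using cb(1)[of t] by (simp add: inv_leaf_to_coset leaf_to_coset_leaf_at)
      then show ?thesis unfolding t' leaf_at_eq_iff coset_eq_iff[OF real_subgroup_holonomy] .
    qed
    with cb(2) show ?thesis unfolding stabilizer_ring_def by blast
  qed
  obtain c b where c: "\<And>t. h (leaf_at \<xi> t) = leaf_at \<xi> (c * t + b)" "c \<in> stabilizer_ring ?\<Gamma>"
    using affine[OF dm(1)] bij unfolding bij_betw_def by blast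
  obtain c' b' where c': "\<And>t. inv_into (leaf_space \<xi>) h (leaf_at \<xi> t) = leaf_at \<xi> (c' * t + b')"
    "c' \<in> stabilizer_ring ?\<Gamma>"
    using affine[OF dm(2)] bij_betw_inv_into[OF bij] unfolding bij_betw_def by blast
  \<comment> \<open>The composite of the lifts represents the identity, so it differs from
    \<open>t\<close> by an element of \<Gamma>.\<close>
  have "(c' * c - 1) * t + (c' * b + b') \<in> ?\<Gamma>" for t
  proof -
    have "inv_into (leaf_space \<xi>) h (h (leaf_at \<xi> t)) = leaf_at \<xi> t"
      by (rule bij_betw_inv_into_left[OF bij leaf_at_mem])
    then have "c' * (c * t + b) + b' - t \<in> ?\<Gamma>" unfolding c(1) c'(1) leaf_at_eq_iff .
    then show ?thesis by (simp add: algebra_simps)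
  qed
  then have "c' * c - 1 = 0" by (rule affine_into_countable[OF cnt])
  then have inv: "c \<noteq> 0" "inverse c = c'" by (auto simp: inverse_unique mult.commute)
  show ?thesis
    by (rule that[of c b]) (use inv c c' mult_image_eq_iff[OF inv(1), of ?\<Gamma>] in auto)
qed

section \<open>The semidirect product\<close>

lemma real_quot_mult:
  assumes "real_subgroup \<Gamma>"
  shows "(\<Gamma> #>\<^bsub>real_group\<^esub> s) \<otimes>\<^bsub>real_quot \<Gamma>\<^esub> (\<Gamma> #>\<^bsub>real_group\<^esub> t) = \<Gamma> #>\<^bsub>real_group\<^esub> (s + t)"
proof -
  have c: "\<Gamma> #>\<^bsub>real_group\<^esub> t = {x. x - t \<in> \<Gamma>}" for t
    by (force simp: r_coset_def real_group_def)
  have "x \<in> (\<Gamma> #>\<^bsub>real_group\<^esub> s) <#>\<^bsub>real_group\<^esub> (\<Gamma> #>\<^bsub>real_group\<^esub> t)" if "x - (s + t) \<in> \<Gamma>" for x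
  proof -
    have "x - t \<in> {x. x - s \<in> \<Gamma>}" "t \<in> {x. x - t \<in> \<Gamma>}"
      using that real_subgroup_0[OF assms] by (simp_all add: algebra_simps)
    then show ?thesis unfolding c set_mult_def by (force simp: real_group_def)
  qed
  moreover have "x + y - (s + t) \<in> \<Gamma>" if "x - s \<in> \<Gamma>" "y - t \<in> \<Gamma>" for x y
    using real_subgroup_add[OF assms that] by (simp add: algebra_simps)
  ultimately show ?thesis
    unfolding FactGroup_def c by (auto simp: set_mult_def real_group_def)
qed

text \<open>Closure under the product is enough to reverse an isomorphism, so the group laws of the
  semidirect product need not be established first.\<close>

lemma iso_inv_into:
  assumes h: "h \<in> iso G H" and closed: "\<And>x y. x \<in> carrier G \<Longrightarrow> y \<in> carrier G \<Longrightarrow> x \<otimes>\<^bsub>G\<^esub> y \<in> carrier G"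
  shows "inv_into (carrier G) h \<in> iso H G"
proof -
  have bij: "bij_betw h (carrier G) (carrier H)"
    and mult: "\<And>x y. x \<in> carrier G \<Longrightarrow> y \<in> carrier G \<Longrightarrow> h (x \<otimes>\<^bsub>G\<^esub> y) = h x \<otimes>\<^bsub>H\<^esub> h y"
    using h by (auto simp: iso_def hom_def)
  let ?k = "inv_into (carrier G) h"
  have bij': "bij_betw ?k (carrier H) (carrier G)" by (rule bij_betw_inv_into[OF bij])
  have "?k (x \<otimes>\<^bsub>H\<^esub> y) = ?k x \<otimes>\<^bsub>G\<^esub> ?k y" if "x \<in> carrier H" "y \<in> carrier H" for x y
  proof -
    have k: "?k x \<in> carrier G" "?k y \<in> carrier G" using bij' that by (auto simp: bij_betw_def)
    have "h (?k x \<otimes>\<^bsub>G\<^esub> ?k y) = x \<otimes>\<^bsub>H\<^esub> y"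
      unfolding mult[OF k] using that by (simp add: bij_betw_inv_into_right[OF bij])
    then show ?thesis using bij closed[OF k] by (metis bij_betw_inv_into_left)
  qed
  with bij' show ?thesis by (auto simp: iso_def hom_def bij_betw_def)
qed

theorem corollary6p6:
  fixes \<xi> :: "real^'m"
  assumes "\<exists>i. \<xi> $ i \<notin> \<rat>"
  shows "\<exists>r \<le> CARD('m). \<exists>\<phi> \<in> iso (Z2_times_Z_power r) (Aut_lin (holonomy \<xi>)).
           Diff (leaf_space \<xi>) (leaf_diffeology \<xi>)
             \<cong> semidirect (Z2_times_Z_power r) (real_quot (holonomy \<xi>)) (\<lambda>a C. \<phi> a ` C)"
proof -
  let ?\<Gamma> = "holonomy \<xi>" and ?pi = "\<lambda>t. holonomy \<xi> #>\<^bsub>real_group\<^esub> t"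
  let ?D = "Diff (leaf_space \<xi>) (leaf_diffeology \<xi>)"
  obtain i where i: "\<xi> $ i \<notin> \<rat>" using assms by blast
  obtain n g where n: "n \<le> Suc CARD('m)" and g: "?\<Gamma> = int_span g n" "int_indep g n" "1 \<in> int_span g n"
    by (rule holonomy_has_basis)
  obtain r \<phi> where r: "r \<le> n - 1" and \<phi>: "\<phi> \<in> iso (Z2_times_Z_power r) (Aut_lin ?\<Gamma>)"
    using Aut_lin_iso[OF g(2,3)] g(1) by metis
  let ?Z = "Z2_times_Z_power r"
  let ?S = "semidirect ?Z (real_quot ?\<Gamma>) (\<lambda>a C. \<phi> a ` C)"
  have cnt: "countable ?\<Gamma>" unfolding g(1) by (rule countable_int_span)
  have \<phi>bij: "bij_betw \<phi> (carrier ?Z) (carrier (Aut_lin ?\<Gamma>))"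
    and \<phi>mult: "\<And>a a'. a \<in> carrier ?Z \<Longrightarrow> a' \<in> carrier ?Z \<Longrightarrow> \<phi> (a \<otimes>\<^bsub>?Z\<^esub> a') = \<phi> a \<otimes>\<^bsub>Aut_lin ?\<Gamma>\<^esub> \<phi> a'"
    using \<phi> by (auto simp: iso_def hom_def)
  have slope: "\<exists>c. c \<noteq> 0 \<and> \<phi> a = (\<lambda>t. c * t) \<and> (\<lambda>t. c * t) ` ?\<Gamma> = ?\<Gamma>" if "a \<in> carrier ?Z" for a
  proof -
    have "\<phi> a \<in> carrier (Aut_lin ?\<Gamma>)" using \<phi>bij that by (auto simp: bij_betw_def)
    then show ?thesis by (auto simp: Aut_lin_def)
  qed
  have Zclosed: "a \<otimes>\<^bsub>?Z\<^esub> a' \<in> carrier ?Z" if "a \<in> carrier ?Z" "a' \<in> carrier ?Z" for a a'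
    using that by (cases a; cases a') (simp add: carrier_Z2_times_Z_power mult_Z2_times_Z_power)
  have \<phi>comp: "\<phi> (a \<otimes>\<^bsub>?Z\<^esub> a') t = \<phi> a (\<phi> a' t)" if a: "a \<in> carrier ?Z" "a' \<in> carrier ?Z" for a a' t
  proof -
    have "\<phi> a \<in> Bij UNIV" "\<phi> a' \<in> Bij UNIV" using slope a linear_in_Bij by metis+
    then show ?thesis unfolding \<phi>mult[OF a] by (simp add: Aut_lin_def BijGroup_def compose_def)
  qed
  have carS: "carrier ?S = carrier ?Z \<times> range ?pi"
    by (auto simp: semidirect_def FactGroup_def RCOSETS_def) (auto simp: real_group_def)
  have multS: "(a, ?pi b) \<otimes>\<^bsub>?S\<^esub> (a', ?pi b') = (a \<otimes>\<^bsub>?Z\<^esub> a', ?pi (b + \<phi> a b'))"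
    if a: "a \<in> carrier ?Z" for a a' b b'
  proof -
    obtain c where c: "\<phi> a = (\<lambda>t. c * t)" "(\<lambda>t. c * t) ` ?\<Gamma> = ?\<Gamma>" using slope[OF a] by blast
    have "\<phi> a ` ?pi b' = ?pi (\<phi> a b')" using coset_affine_image[OF c(2), of 0] by (simp add: c(1))
    then show ?thesis
      using real_quot_mult[OF real_subgroup_holonomy, of \<xi> b "\<phi> a b'"] by (simp add: semidirect_def)
  qed
  \<comment> \<open>The pair \<open>(a, ?pi b)\<close> is to act by
    \<open>t \<mapsto> \<phi> a t + b\<close>. Representatives are picked by choice; the result does
    not depend on them because \<open>\<phi> a\<close> preserves \<Gamma>.\<close>
  define \<Psi> where "\<Psi> = (\<lambda>(a, C). \<lambda>L\<in>leaf_space \<xi>.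
    leaf_at \<xi> (\<phi> a (SOME t. leaf_at \<xi> t = L) + (SOME b. ?pi b = C)))"
  have \<Psi>: "\<Psi> (a, ?pi b) (leaf_at \<xi> t) = leaf_at \<xi> (\<phi> a t + b)" if a: "a \<in> carrier ?Z" for a b t
  proof -
    obtain c where c: "\<phi> a = (\<lambda>t. c * t)" "(\<lambda>t. c * t) ` ?\<Gamma> = ?\<Gamma>" using slope[OF a] by blast
    define t' where "t' = (SOME t'. leaf_at \<xi> t' = leaf_at \<xi> t)"
    define b' where "b' = (SOME b'. ?pi b' = ?pi b)"
    have "leaf_at \<xi> t' = leaf_at \<xi> t" unfolding t'_def by (rule someI) (rule refl)
    then have "c * (t' - t) \<in> ?\<Gamma>" using c(2) by (auto simp: leaf_at_eq_iff)
    moreover have "?pi b' = ?pi b" unfolding b'_def by (rule someI) (rule refl)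
    then have "b' - b \<in> ?\<Gamma>" by (simp add: coset_eq_iff[OF real_subgroup_holonomy])
    ultimately have "c * (t' - t) + (b' - b) \<in> ?\<Gamma>" by (rule holonomy_add)
    then have "leaf_at \<xi> (\<phi> a t' + b') = leaf_at \<xi> (\<phi> a t + b)"
      by (simp add: leaf_at_eq_iff c(1) algebra_simps)
    then show ?thesis unfolding \<Psi>_def by (simp add: leaf_at_mem t'_def b'_def)
  qed
  have \<Psi>ext: "\<Psi> x \<in> extensional (leaf_space \<xi>)" for x by (cases x) (simp add: \<Psi>_def)
  have \<Psi>car: "\<Psi> x \<in> carrier ?D" if xS: "x \<in> carrier ?S" for x
  proof -
    obtain a b where x: "x = (a, ?pi b)" "a \<in> carrier ?Z" using xS unfolding carS by blast
    obtain c where c: "c \<noteq> 0" "\<phi> a = (\<lambda>t. c * t)" "(\<lambda>t. c * t) ` ?\<Gamma> = ?\<Gamma>" using slope[OF x(2)] by blast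
    show ?thesis
      unfolding x(1) by (rule affine_in_Diff[OF c(1,3) \<Psi>ext, of _ b]) (simp add: \<Psi>[OF x(2)] c(2))
  qed
  have "\<Psi> \<in> iso ?S ?D"
    unfolding iso_def hom_def
  proof (intro CollectI conjI ballI)
    show "\<Psi> \<in> carrier ?S \<rightarrow> carrier ?D" using \<Psi>car by blast
    show "\<Psi> (x \<otimes>\<^bsub>?S\<^esub> y) = \<Psi> x \<otimes>\<^bsub>?D\<^esub> \<Psi> y" if xy: "x \<in> carrier ?S" "y \<in> carrier ?S" for x y
    proof -
      obtain a b a' b' where ab: "x = (a, ?pi b)" "y = (a', ?pi b')" "a \<in> carrier ?Z" "a' \<in> carrier ?Z"
        using xy(1,2) unfolding carS by blast
      have "\<Psi> x \<in> Bij (leaf_space \<xi>)" "\<Psi> y \<in> Bij (leaf_space \<xi>)"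
        using \<Psi>car xy by (auto simp: Diff_def)
      then have prod: "\<Psi> x \<otimes>\<^bsub>?D\<^esub> \<Psi> y = compose (leaf_space \<xi>) (\<Psi> x) (\<Psi> y)"
        by (simp add: Diff_def BijGroup_def)
      obtain c where c: "\<phi> a = (\<lambda>t. c * t)" using slope[OF ab(3)] by blast
      show ?thesis
        unfolding prod
      proof (rule extensionalityI[OF \<Psi>ext compose_extensional])
        \<comment> \<open>On the leaf at \<open>t\<close> the composite is
          \<open>c * (\<phi> a' t + b') + b\<close>; its translation part \<open>b + c * b'\<close>
          is that of the semidirect product.\<close>
        fix L assume "L \<in> leaf_space \<xi>"
        then obtain t where L: "L = leaf_at \<xi> t" unfolding leaf_space_eq by blast
        show "\<Psi> (x \<otimes>\<^bsub>?S\<^esub> y) L = compose (leaf_space \<xi>) (\<Psi> x) (\<Psi> y) L"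
          unfolding L ab(1,2) multS[OF ab(3)]
          by (simp add: compose_def leaf_at_mem \<Psi>[OF Zclosed[OF ab(3,4)]] \<Psi>[OF ab(3)] \<Psi>[OF ab(4)]
              \<phi>comp[OF ab(3,4)]) (simp add: c algebra_simps)
      qed
    qed
    show "bij_betw \<Psi> (carrier ?S) (carrier ?D)"
      unfolding bij_betw_def
    proof
      show "inj_on \<Psi> (carrier ?S)"
      proof (rule inj_onI)
        fix x y assume xy: "x \<in> carrier ?S" "y \<in> carrier ?S" "\<Psi> x = \<Psi> y"
        obtain a b a' b' where ab: "x = (a, ?pi b)" "y = (a', ?pi b')" "a \<in> carrier ?Z" "a' \<in> carrier ?Z"
          using xy(1,2) unfolding carS by blast
        obtain c c' where c: "\<phi> a = (\<lambda>t. c * t)" "\<phi> a' = (\<lambda>t. c' * t)"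
          using slope[OF ab(3)] slope[OF ab(4)] by blast
        \<comment> \<open>Equal images put a whole affine map into \<Gamma>: its slope vanishes,
          which identifies the multipliers, and \<open>t = 0\<close> identifies the cosets.\<close>
        have diff: "(c - c') * t + (b - b') \<in> ?\<Gamma>" for t
        proof -
          have "leaf_at \<xi> (\<phi> a t + b) = leaf_at \<xi> (\<phi> a' t + b')"
            using fun_cong[OF xy(3), of "leaf_at \<xi> t"] by (simp add: ab \<Psi>)
          then show ?thesis by (simp add: leaf_at_eq_iff c algebra_simps)
        qed
        then have "c - c' = 0" by (rule affine_into_countable[OF cnt])
        then have "\<phi> a = \<phi> a'" by (simp add: c)
        then have "a = a'" using \<phi>bij ab(3,4) by (auto simp: bij_betw_def inj_on_def)
        moreover have "?pi b = ?pi b'" using diff[of 0] by (simp add: coset_eq_iff[OF real_subgroup_holonomy])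
        ultimately show "x = y" by (simp add: ab)
      qed
      have "h \<in> \<Psi> ` carrier ?S" if h: "h \<in> carrier ?D" for h
      proof -
        obtain c b where c: "c \<noteq> 0" "(\<lambda>t. c * t) ` ?\<Gamma> = ?\<Gamma>" "\<And>t. h (leaf_at \<xi> t) = leaf_at \<xi> (c * t + b)"
          using Diff_is_affine[OF i h] by blast
        then have "(\<lambda>t. c * t) \<in> carrier (Aut_lin ?\<Gamma>)" by (auto simp: Aut_lin_def)
        then obtain a where a: "a \<in> carrier ?Z" "\<phi> a = (\<lambda>t. c * t)"
          using \<phi>bij unfolding bij_betw_def by (metis imageE)
        have "h = \<Psi> (a, ?pi b)"
        proof (rule extensionalityI[OF _ \<Psi>ext])
          show "h \<in> extensional (leaf_space \<xi>)" using h by (simp add: Diff_def Bij_def)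
          fix L assume "L \<in> leaf_space \<xi>"
          then obtain t where L: "L = leaf_at \<xi> t" unfolding leaf_space_eq by blast
          show "h L = \<Psi> (a, ?pi b) L" unfolding L \<Psi>[OF a(1)] c(3) a(2) ..
        qed
        then show ?thesis by (rule image_eqI) (use a(1) in \<open>simp add: carS\<close>)
      qed
      then show "\<Psi> ` carrier ?S = carrier ?D" using \<Psi>car by blast
    qed
  qed
  then have "inv_into (carrier ?S) \<Psi> \<in> iso ?D ?S"
  proof (rule iso_inv_into)
    fix x y assume "x \<in> carrier ?S" "y \<in> carrier ?S"
    then show "x \<otimes>\<^bsub>?S\<^esub> y \<in> carrier ?S"
      unfolding carS using multS Zclosed by auto
  qed
  then have "?D \<cong> ?S" unfolding is_iso_def by blast
  with r n \<phi> show ?thesis by (intro exI[of _ r] conjI bexI[of _ \<phi>]) auto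
qed

end
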